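(* Let $\mathbb K$ be a field of characteristic zero, let $A\subset\mathbb K^{d+1}$ be a non-pyramidal homogeneous configuration of affine dimension $d$ with a Cayley decomposition $A=A_0\ast\cdots\ast A_r$, let $B$ be a Gale dual of $A$, and let $B=B_0\cup\dots\cup B_r$ be the corresponding decomposition, where $B_j$ consists of the elements $b_i$ such that $a_i\in\{e_j\}\times A_j$. Let $c$ be the minimal dimension of a subspace $S\subset\mathbb K^{d+1}$ such that, under the projection $\pi:\mathbb K^{d+1}\to\mathbb K^{d+1}/S$, the image $\pi(A)=\pi(A_0)\ast\cdots\ast\pi(A_r)$ is a join. Then for each $j=0,\dots,r$ the configuration $B_j$ is dual-homogeneous, and $$c=\sum_{j=0}^r\dim L(B_j)-\dim L(B).$$
   Context: A configuration is a finite indexed family $A=\{a_1,\dots,a_n\}$ of not necessarily distinct vectors, identified with the matrix with columns $a_i$. $A$ is homogeneous if $(1,\dots,1)$ lies in the row span of the matrix. $A$ is a pyramid if some affine hyperplane contains all points of $A$ except one (equivalently, some $a_i$ is not in the affine span of the other points); otherwise it is non-pyramidal. The affine dimension is the dimension of the affine span. $L(\cdot)$ denotes linear span. Cayley decomposition of length $r$: after a linear isomorphism $\mathbb K^{d+1}\cong\mathbb K^{r+1}\times\mathbb K^{d-r}$, $A=\{e_0\}\times A_0\cup\dots\cup\{e_r\}\times A_r$, where $e_0,\dots,e_r$ is the canonical basis of $\mathbb K^{r+1}$ and $A_0,\dots,A_r\subset\mathbb K^{d-r}$ are nonempty configurations; one writes $A=A_0\ast\cdots\ast A_r$. It is a join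 if the sum map $\bigoplus_{j}\langle A_j-A_j\rangle\to\mathbb K^{d-r}$ is an isomorphism, where $\langle A_j-A_j\rangle$ is the linear span of the differences of elements of $A_j$. For a subspace $S\subset\{0\}\times\mathbb K^{d-r}$, the image $\pi(A)$ in $\mathbb K^{d+1}/S$ has the induced Cayley decomposition $\pi(A_0)\ast\cdots\ast\pi(A_r)$ with $\pi(A_j)\subset\mathbb K^{d-r}/S$; only such $S$ are considered. Gale dual: $B=\{b_1,\dots,b_n\}$ is the family of rows of a matrix whose columns are a basis of $\ker_{\mathbb K}(A)$. A configuration $C$ is dual-homogeneous if $\sum_{b\in C}b=0$. *)

theory Defs
  imports "Jordan_Normal_Form.Matrix_Kernel" "HOL-Algebra.AbelCoset"
begin

text \<open>
  A configuration \<open>a_0, ..., a_{n-1}\<close> in \<open>K^m\<close> is an \<open>m \<times> n\<close> matrix, \<open>a_i\<close> being its column \<open>i\<close>.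
  Subconfigurations are given by sets of indices, so that repeated vectors are kept apart.
\<close>

definition lin_span :: "nat \<Rightarrow> 'a::field vec set \<Rightarrow> 'a vec set" where
  "lin_span m X = LinearCombinations.module.span class_ring (module_vec TYPE('a) m) X"

definition lin_dim :: "nat \<Rightarrow> 'a::field vec set \<Rightarrow> nat" where
  "lin_dim m W = vectorspace.dim class_ring ((module_vec TYPE('a) m)\<lparr>carrier := W\<rparr>)"

definition homogeneous :: "'a::field mat \<Rightarrow> bool" where
  "homogeneous A \<longleftrightarrow> vec (dim_col A) (\<lambda>_. 1) \<in> lin_span (dim_col A) (set (rows A))"

definition affine_span :: "'a::field mat \<Rightarrow> 'a vec set" where
  "affine_span A = {A *\<^sub>v l | l. l \<in> carrier_vec (dim_col A) \<and> (\<Sum>i<dim_col A. l $ i) = 1}"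

text \<open>The dimension of an affine space is that of its space of directions.\<close>

definition affine_dim :: "'a::field mat \<Rightarrow> nat" where
  "affine_dim A = lin_dim (dim_row A)
     (lin_span (dim_row A) {x - y | x y. x \<in> affine_span A \<and> y \<in> affine_span A})"

definition affine_hyperplane :: "nat \<Rightarrow> 'a::field vec set \<Rightarrow> bool" where
  "affine_hyperplane m H \<longleftrightarrow>
     (\<exists>h\<in>carrier_vec m. \<exists>c. h \<noteq> 0\<^sub>v m \<and> H = {x \<in> carrier_vec m. h \<bullet> x = c})"

definition pyramid :: "'a::field mat \<Rightarrow> bool" where
  "pyramid A \<longleftrightarrow> (\<exists>H. affine_hyperplane (dim_row A) H \<and>
     (\<exists>i<dim_col A. col A i \<notin> H \<and> (\<forall>k<dim_col A. k \<noteq> i \<longrightarrow> col A k \<in> H)))"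

text \<open>
  \<open>K^{r+1} \<times> K^{d-r}\<close> is realised on vectors of length \<open>d+1\<close> by concatenation, and the linear
  isomorphism from \<open>K^{d+1}\<close> onto it is the invertible matrix \<open>T\<close>. The image of \<open>a_i\<close> is
  \<open>(e_{g i}, w i)\<close>, so \<open>A_j\<close> is the family of the \<open>w i\<close> with \<open>g i = j\<close>; surjectivity of \<open>g\<close>
  says that \<open>A_0, ..., A_r\<close> are nonempty.
\<close>

definition cayley_decomposition ::
  "nat \<Rightarrow> nat \<Rightarrow> 'a::field mat \<Rightarrow> 'a mat \<Rightarrow> (nat \<Rightarrow> nat) \<Rightarrow> (nat \<Rightarrow> 'a vec) \<Rightarrow> bool" where
  "cayley_decomposition d r A T g w \<longleftrightarrow>
     r \<le> d \<and> T \<in> carrier_mat (d + 1) (d + 1) \<and> invertible_mat T \<and>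
     g ` {..<dim_col A} = {..r} \<and>
     (\<forall>i<dim_col A. w i \<in> carrier_vec (d - r) \<and>
        T *\<^sub>v col A i = unit_vec (r + 1) (g i) @\<^sub>v w i)"

definition part :: "nat \<Rightarrow> (nat \<Rightarrow> nat) \<Rightarrow> nat \<Rightarrow> nat set" where
  "part n g j = {i. i < n \<and> g i = j}"

text \<open>The quotient of a module by a submodule: its elements are the additive cosets.\<close>

definition quotient_space ::
  "('a, 'v, 'm) module_scheme \<Rightarrow> 'v set \<Rightarrow> ('a, 'v set) module" where
  "quotient_space V S = \<lparr>
     carrier = a_rcosets\<^bsub>V\<^esub> S,
     mult = undefined,
     one = undefined,
     zero = S,
     add = set_add V,
     smult = (\<lambda>c X. \<Union>x\<in>X. S +>\<^bsub>V\<^esub> (c \<odot>\<^bsub>V\<^esub> x))\<rparr>"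

definition difference_span ::
  "('a::field, 'v, 'm) module_scheme \<Rightarrow> (nat \<Rightarrow> 'v) \<Rightarrow> nat set \<Rightarrow> 'v set" where
  "difference_span V v I =
     LinearCombinations.module.span class_ring V {v i \<ominus>\<^bsub>V\<^esub> v k | i k. i \<in> I \<and> k \<in> I}"

text \<open>
  The family \<open>v 0, ..., v (n-1)\<close> in \<open>V\<close> is split into the blocks \<open>part n g j\<close>, \<open>j \<le> r\<close>. The external
  direct sum of the spans is the set of dependent functions on \<open>{..r}\<close>; the sum map
  is linear, so it is an isomorphism iff it is bijective.
\<close>

definition is_join ::
  "('a::field, 'v, 'm) module_scheme \<Rightarrow> nat \<Rightarrow> nat \<Rightarrow> (nat \<Rightarrow> nat) \<Rightarrow> (nat \<Rightarrow> 'v) \<Rightarrow> bool" where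
  "is_join V r n g v \<longleftrightarrow>
     bij_betw (\<lambda>u. finsum V u {..r})
       (\<Pi>\<^sub>E j\<in>{..r}. difference_span V v (part n g j)) (carrier V)"

text \<open>
  \<open>S\<close> is a subspace of \<open>K^{d+1}\<close> which \<open>T\<close> maps into \<open>{0} \<times> K^{d-r}\<close>, and \<open>fibre_part d r T S\<close> is
  its image, viewed in \<open>K^{d-r}\<close>. The induced Cayley decomposition of the image of \<open>A\<close> in
  \<open>K^{d+1}/S\<close> consists of the images of the \<open>A_j\<close> in \<open>K^{d-r}/S\<close>.
\<close>

definition fibre_part :: "nat \<Rightarrow> nat \<Rightarrow> 'a::field mat \<Rightarrow> 'a vec set \<Rightarrow> 'a vec set" where
  "fibre_part d r T S = {u \<in> carrier_vec (d - r). 0\<^sub>v (r + 1) @\<^sub>v u \<in> (*\<^sub>v) T ` S}"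

definition projects_to_join ::
  "nat \<Rightarrow> nat \<Rightarrow> nat \<Rightarrow> 'a::field mat \<Rightarrow> (nat \<Rightarrow> nat) \<Rightarrow> (nat \<Rightarrow> 'a vec) \<Rightarrow> 'a vec set \<Rightarrow> bool" where
  "projects_to_join d r n T g w S \<longleftrightarrow>
     VectorSpace.subspace class_ring S (module_vec TYPE('a) (d + 1)) \<and>
     (*\<^sub>v) T ` S \<subseteq> {0\<^sub>v (r + 1) @\<^sub>v u | u. u \<in> carrier_vec (d - r)} \<and>
     is_join (quotient_space (module_vec TYPE('a) (d - r)) (fibre_part d r T S)) r n g
       (\<lambda>i. fibre_part d r T S +>\<^bsub>module_vec TYPE('a) (d - r)\<^esub> w i)"

text \<open>The Gale dual configuration \<open>b_0, ..., b_{n-1}\<close> consists of the rows of \<open>B\<close>.\<close>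

definition gale_dual :: "'a::field mat \<Rightarrow> 'a mat \<Rightarrow> bool" where
  "gale_dual A B \<longleftrightarrow> dim_row B = dim_col A \<and> distinct (cols B) \<and>
     vectorspace.basis class_ring
       ((module_vec TYPE('a) (dim_col A))\<lparr>carrier := mat_kernel A\<rparr>) (set (cols B))"

definition dual_homogeneous :: "'a::field mat \<Rightarrow> nat set \<Rightarrow> bool" where
  "dual_homogeneous B I \<longleftrightarrow> finsum_vec TYPE('a) (dim_col B) (row B) I = 0\<^sub>v (dim_col B)"

definition row_span :: "'a::field mat \<Rightarrow> nat set \<Rightarrow> 'a vec set" where
  "row_span B I = lin_span (dim_col B) (row B ` I)"

end

theory Submission
  imports Defs "Jordan_Normal_Form.DL_Rank"
begin

text \<open>
  Write \<open>N \<subseteq> K\<^sup>n\<close> for the kernel of \<open>A\<close>, and \<open>P\<^sub>j\<close> for the projection of \<open>K\<^sup>n\<close> that keeps the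
  coordinates in the \<open>j\<close>-th part and clears the others. The columns of \<open>B\<close> are a basis of \<open>N\<close>, so
  equality of row rank and column rank gives \<open>dim L(B\<^sub>j) = dim P\<^sub>j N\<close> and \<open>dim L(B) = dim N\<close>
  (\<open>lin_dim_row_span\<close>). In Cayley coordinates the first \<open>r + 1\<close> entries of \<open>A l\<close> are the sums of
  \<open>l\<close> over the parts, and the others are \<open>\<Sum>\<^sub>i l\<^sub>i w\<^sub>i\<close> (\<open>cayley_mult_vec\<close>). Hence every element of
  \<open>N\<close> is balanced, that is, sums to zero over each part; for the columns of \<open>B\<close> this is
  dual homogeneity of the \<open>B\<^sub>j\<close>.

  For the formula, let \<open>R\<close> be the sum of the \<open>P\<^sub>j N\<close> in \<open>K\<^sup>n\<close>. The image \<open>A R\<close> turns out to be the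
  least subspace that makes the projection of \<open>A\<close> a join. Indeed, the span of \<open>A\<^sub>j - A\<^sub>j\<close>
  consists of the combinations of the \<open>w\<^sub>i\<close> whose coefficients are supported on part \<open>j\<close> and have
  sum zero (\<open>difference_span_eq_image\<close>). Since \<open>A\<close> spans \<open>K\<^sup>d\<^sup>+\<^sup>1\<close> (\<open>full_affine_dim_imp_surj\<close>), these
  spans together generate \<open>K\<^sup>d\<^sup>-\<^sup>r\<close>, so only injectivity of the sum map is in question. For a subspace \<open>S\<close> of
  the fibre \<open>{0} \<times> K\<^sup>d\<^sup>-\<^sup>r\<close>, the image modulo \<open>S\<close> is a join iff for every balanced \<open>l\<close>
    \<open>A l \<in> S\<close> implies \<open>A (P\<^sub>j l) \<in> S\<close> for all \<open>j\<close>
  (\<open>is_join_quotient_coeff\<close>). Taking \<open>l \<in> N\<close> shows that such an \<open>S\<close> contains \<open>A R\<close>. Conversely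
  \<open>A R\<close> lies in the fibre, the elements of \<open>R\<close> being balanced, and \<open>S = A R\<close> has this property: if \<open>A l = A v\<close> with \<open>v \<in> R\<close>, then \<open>l - v \<in> N\<close>, so
  \<open>P\<^sub>j l = P\<^sub>j (l - v) + P\<^sub>j v\<close> lies in \<open>R\<close>.

  Therefore \<open>c = dim A R\<close>. As \<open>N \<subseteq> R\<close>, the kernel of \<open>A\<close> on \<open>R\<close> is \<open>N\<close>, and
  \<open>c = dim R - dim N = \<Sum>\<^sub>j dim P\<^sub>j N - dim N\<close>, the sum defining \<open>R\<close> being direct
  (\<open>lin_dim_block_sum\<close>).
\<close>

section \<open>Subspaces of \<open>K\<^sup>m\<close> and their dimensions\<close>

abbreviation is_subspace :: "nat \<Rightarrow> 'a::field vec set \<Rightarrow> bool" where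
  "is_subspace m W \<equiv> VectorSpace.subspace class_ring W (module_vec TYPE('a) m)"

lemma is_subspace_iff:
  fixes W :: "'a::field vec set"
  shows "is_subspace m W \<longleftrightarrow> W \<subseteq> carrier_vec m \<and> 0\<^sub>v m \<in> W \<and>
    (\<forall>x\<in>W. \<forall>y\<in>W. x + y \<in> W) \<and> (\<forall>c. \<forall>x\<in>W. c \<cdot>\<^sub>v x \<in> W)"
proof -
  interpret vec_space "TYPE('a)" m .
  show ?thesis
    using vec_vs[of m, where 'a='a] vec_module[of m, where 'a='a]
    unfolding VectorSpace.subspace_def LinearCombinations.submodule_def
    by (auto simp: module_vec_simps class_ring_simps)
qed

lemma mult_mat_zero_vec:
  fixes M :: "'a::comm_ring_1 mat"
  assumes "M \<in> carrier_mat p m"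
  shows "M *\<^sub>v 0\<^sub>v m = 0\<^sub>v p"
  using assms by (intro eq_vecI) auto

lemma is_subspaceI:
  fixes W :: "'a::field vec set"
  assumes "W \<subseteq> carrier_vec m" "0\<^sub>v m \<in> W" "\<And>x y. x \<in> W \<Longrightarrow> y \<in> W \<Longrightarrow> x + y \<in> W"
    "\<And>c x. x \<in> W \<Longrightarrow> c \<cdot>\<^sub>v x \<in> W"
  shows "is_subspace m W"
  using assms unfolding is_subspace_iff by blast

lemma is_subspaceD:
  fixes W :: "'a::field vec set"
  assumes "is_subspace m W"
  shows "W \<subseteq> carrier_vec m" "0\<^sub>v m \<in> W" "x \<in> W \<Longrightarrow> y \<in> W \<Longrightarrow> x + y \<in> W"
    "x \<in> W \<Longrightarrow> c \<cdot>\<^sub>v x \<in> W" "x \<in> W \<Longrightarrow> y \<in> W \<Longrightarrow> x - y \<in> W"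
proof -
  show 1: "W \<subseteq> carrier_vec m" "0\<^sub>v m \<in> W" "x \<in> W \<Longrightarrow> y \<in> W \<Longrightarrow> x + y \<in> W" 
    and 2: "x \<in> W \<Longrightarrow> c \<cdot>\<^sub>v x \<in> W" for x y c
    using assms unfolding is_subspace_iff by blast+
  assume xy: "x \<in> W" "y \<in> W"
  have "x - y = x + (-1) \<cdot>\<^sub>v y" using xy 1(1) by (intro eq_vecI) auto
  thus "x - y \<in> W" using 1(3)[OF xy(1) 2[OF xy(2)]] by simp
qed

lemma is_subspace_carrier: "is_subspace m (carrier_vec m)"
  by (intro is_subspaceI) auto

lemma is_subspace_image:
  fixes W :: "'a::field vec set"
  assumes W: "is_subspace m W" and M: "M \<in> carrier_mat p m"
  shows "is_subspace p ((*\<^sub>v) M ` W)"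
proof (rule is_subspaceI)
  note WD = is_subspaceD[OF W]
  show "(*\<^sub>v) M ` W \<subseteq> carrier_vec p" using M WD(1) mult_mat_vec_carrier[OF M] by blast
  show "0\<^sub>v p \<in> (*\<^sub>v) M ` W"
    using WD(2) mult_mat_zero_vec[OF M] by (metis imageI)
  show "x + y \<in> (*\<^sub>v) M ` W" if "x \<in> (*\<^sub>v) M ` W" "y \<in> (*\<^sub>v) M ` W" for x y
  proof -
    from that obtain u v where u: "u \<in> W" "x = M *\<^sub>v u" and v: "v \<in> W" "y = M *\<^sub>v v" by auto
    have "x + y = M *\<^sub>v (u + v)" using mult_add_distrib_mat_vec[OF M] u v subsetD[OF WD(1)] by simp
    thus ?thesis using WD(3)[OF u(1) v(1)] by blast
  qed
  show "c \<cdot>\<^sub>v x \<in> (*\<^sub>v) M ` W" if "x \<in> (*\<^sub>v) M ` W" for c x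
  proof -
    from that obtain u where u: "u \<in> W" "x = M *\<^sub>v u" by auto
    have "c \<cdot>\<^sub>v x = M *\<^sub>v (c \<cdot>\<^sub>v u)" using mult_mat_vec[OF M] u WD(1) by auto
    thus ?thesis using WD(4)[OF u(1)] by blast
  qed
qed

lemma is_subspace_preimage:
  fixes W :: "'a::field vec set"
  assumes V: "is_subspace m V" and W: "is_subspace p W" and M: "M \<in> carrier_mat p m"
  shows "is_subspace m {x \<in> V. M *\<^sub>v x \<in> W}"
proof (rule is_subspaceI)
  note VD = is_subspaceD[OF V] and WD = is_subspaceD[OF W]
  show "{x \<in> V. M *\<^sub>v x \<in> W} \<subseteq> carrier_vec m" using VD by auto
  show "0\<^sub>v m \<in> {x \<in> V. M *\<^sub>v x \<in> W}"
    using VD(2) WD(2) mult_mat_zero_vec[OF M] by simp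
  show "x + y \<in> {x \<in> V. M *\<^sub>v x \<in> W}"
    if "x \<in> {x \<in> V. M *\<^sub>v x \<in> W}" "y \<in> {x \<in> V. M *\<^sub>v x \<in> W}" for x y
  proof -
    have "M *\<^sub>v (x + y) = M *\<^sub>v x + M *\<^sub>v y" using that VD(1) mult_add_distrib_mat_vec[OF M] by auto
    thus ?thesis using that VD WD by auto
  qed
  show "c \<cdot>\<^sub>v x \<in> {x \<in> V. M *\<^sub>v x \<in> W}" if "x \<in> {x \<in> V. M *\<^sub>v x \<in> W}" for c x
  proof -
    have "M *\<^sub>v (c \<cdot>\<^sub>v x) = c \<cdot>\<^sub>v (M *\<^sub>v x)" using that VD(1) mult_mat_vec[OF M] by auto
    thus ?thesis using that VD WD by auto
  qed
qed

lemma is_subspace_zero: "is_subspace m {0\<^sub>v m}"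
  by (intro is_subspaceI) auto

text \<open>
  Independent subsets of \<open>W\<close> stay independent in \<open>V\<close>, which bounds their size; a maximal one is a
  basis.
\<close>

lemma (in vectorspace) fin_dim_subspace:
  assumes fd: "fin_dim" and W: "subspace K W V"
  shows "vectorspace.fin_dim K (vs W)"
proof -
  interpret W: vectorspace K "vs W" by (rule subspace_is_vs[OF W])
  have sub: "submodule K W V" and WV: "W \<subseteq> carrier V"
    using W by (auto simp: subspace_def submodule_def)
  have li: "finite S \<and> card S \<le> dim" if "S \<subseteq> carrier (vs W) \<and> W.lin_indpt S" for S
  proof -
    have "S \<subseteq> W" using that by simp
    have "lin_indpt S" using span_li_not_depend(2)[OF \<open>S \<subseteq> W\<close> sub] that by simp
    thus ?thesis using li_le_dim[OF fd] \<open>S \<subseteq> W\<close> WV by blast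
  qed
  have "{} \<subseteq> carrier (vs W) \<and> W.lin_indpt {}" by (simp add: W.lin_dep_def)
  from maximal_exists[of "\<lambda>S. S \<subseteq> carrier (vs W) \<and> W.lin_indpt S", OF li this]
  obtain S where "finite S" "maximal S (\<lambda>S. S \<subseteq> carrier (vs W) \<and> W.lin_indpt S)" by blast
  hence "W.basis S" by (intro W.max_li_is_basis)
  with \<open>finite S\<close> show ?thesis unfolding W.fin_dim_def W.basis_def by blast
qed

lemma (in vectorspace) subspace_basis:
  assumes fd: "fin_dim" and W: "subspace K W V"
  obtains b where "finite b" "b \<subseteq> W" "lin_indpt b" "span b = W" "card b = vectorspace.dim K (vs W)"
proof -
  interpret W: vectorspace K "vs W" by (rule subspace_is_vs[OF W])
  obtain b where b: "finite b" "W.basis b"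
    using W.finite_basis_exists[OF fin_dim_subspace[OF fd W]] by blast
  have sub: "submodule K W V" using W by (auto simp: subspace_def submodule_def)
  have bW: "b \<subseteq> W" using b(2) unfolding W.basis_def by simp
  show ?thesis
  proof
    show "finite b" "b \<subseteq> W" by fact+
    show "lin_indpt b" "span b = W"
      using span_li_not_depend[OF bW sub] b(2) unfolding W.basis_def by auto
    show "card b = W.dim" using W.dim_basis[OF b] by simp
  qed
qed

lemma lin_dim_basis:
  fixes W :: "'a::field vec set"
  assumes W: "is_subspace m W"
  obtains b where "finite b" "b \<subseteq> W"
    "module.lin_indpt class_ring (module_vec TYPE('a) m) b"
    "lin_span m b = W" "card b = lin_dim m W"
proof -
  interpret vec_space "TYPE('a)" m .
  from subspace_basis[OF fin_dim W] that show ?thesis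
    unfolding lin_span_def lin_dim_def by metis
qed

lemma lin_dim_carrier: "lin_dim m (carrier_vec m :: 'a::field vec set) = m"
proof -
  interpret vec_space "TYPE('a)" m .
  have "module_vec TYPE('a) m\<lparr>carrier := carrier_vec m\<rparr> = module_vec TYPE('a) m"
    by (simp add: module_vec_def)
  thus ?thesis unfolding lin_dim_def using dim_is_n by metis
qed

lemma lin_dim_mono:
  fixes W W' :: "'a::field vec set"
  assumes W: "is_subspace m W" and W': "is_subspace m W'" and sub: "W \<subseteq> W'"
  shows "lin_dim m W \<le> lin_dim m W'"
proof -
  interpret vec_space "TYPE('a)" m .
  interpret W': vectorspace class_ring "vs W'" by (rule subspace_is_vs[OF W'])
  have "W'.dim \<ge> vectorspace.dim class_ring (W'.vs W)"
    by (rule W'.subspace_dim[OF nested_subspaces[OF W' W sub] fin_dim_subspace[OF fin_dim W']])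
      (use fin_dim_subspace[OF fin_dim W] in simp)
  thus ?thesis unfolding lin_dim_def by simp
qed

text \<open>
  A basis of \<open>W\<close> is an independent subset of \<open>W'\<close> with at least \<open>dim W'\<close> elements, hence a basis of
  \<open>W'\<close>.
\<close>

lemma subspace_eqI_lin_dim:
  fixes W W' :: "'a::field vec set"
  assumes W: "is_subspace m W" and W': "is_subspace m W'" and sub: "W \<subseteq> W'"
    and dim: "lin_dim m W' \<le> lin_dim m W"
  shows "W = W'"
proof -
  interpret vec_space "TYPE('a)" m .
  interpret W': vectorspace class_ring "vs W'" by (rule subspace_is_vs[OF W'])
  obtain b where b: "finite b" "b \<subseteq> W" "lin_indpt b" "lin_span m b = W" "card b = lin_dim m W"
    by (rule lin_dim_basis[OF W])
  have sm: "submodule class_ring W' V" using W' by (auto simp: subspace_def)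
  have bW': "b \<subseteq> W'" using b(2) sub by blast
  have "W'.basis b"
  proof (rule W'.dim_li_is_basis[OF fin_dim_subspace[OF fin_dim W'] b(1)])
    show "b \<subseteq> carrier (vs W')" using bW' by simp
    show "W'.lin_indpt b" using span_li_not_depend(2)[OF bW' sm] b(3) by simp
    show "W'.dim \<le> card b" using dim b(5) unfolding lin_dim_def by simp
  qed
  hence "W'.span b = W'" unfolding W'.basis_def by simp
  thus ?thesis using span_li_not_depend(1)[OF bW' sm] b(4) unfolding lin_span_def by simp
qed

text \<open>
  Rank-nullity for the restriction of a matrix to a subspace. It gives the dimension of a sum of
  coordinate blocks, with a projection as the matrix, and that of the least subspace realising a
  join, with the configuration as the matrix.
\<close>

lemma rank_nullity_mat:
  fixes M :: "'a::field mat"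
  assumes W: "is_subspace m W" and M: "M \<in> carrier_mat p m"
  shows "lin_dim m W = lin_dim p ((*\<^sub>v) M ` W) + lin_dim m {x \<in> W. M *\<^sub>v x = 0\<^sub>v p}"
proof -
  interpret V: vec_space "TYPE('a)" m .
  interpret U: vec_space "TYPE('a)" p .
  have WD: "W \<subseteq> carrier_vec m" by (rule is_subspaceD(1)[OF W])
  have hom: "(*\<^sub>v) M \<in> LinearCombinations.module_hom class_ring (V.vs W) U.V"
    using M subsetD[OF WD] mult_add_distrib_mat_vec[OF M] mult_mat_vec[OF M]
    unfolding LinearCombinations.module_hom_def by (auto simp: module_vec_simps class_ring_simps)
  interpret L: linear_map class_ring "V.vs W" U.V "(*\<^sub>v) M"
    using V.subspace_is_vs[OF W] U.vectorspace_axioms hom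
    unfolding linear_map_def mod_hom_def mod_hom_axioms_def vectorspace_def by simp
  have "L.im = (*\<^sub>v) M ` W" "L.ker = {x \<in> W. M *\<^sub>v x = 0\<^sub>v p}"
    unfolding L.im_def L.ker_def by (auto simp: module_vec_simps)
  thus ?thesis using L.rank_nullity[OF V.fin_dim_subspace[OF V.fin_dim W]]
    unfolding lin_dim_def by simp
qed

lemma lin_dim_zero: "lin_dim m {0\<^sub>v m :: 'a::field vec} = 0"
proof -
  have "(*\<^sub>v) (1\<^sub>m m :: 'a mat) ` {0\<^sub>v m} = {0\<^sub>v m}" by auto
  moreover have "{x \<in> {0\<^sub>v m}. 1\<^sub>m m *\<^sub>v x = 0\<^sub>v m} = {0\<^sub>v m :: 'a vec}" by auto
  ultimately show ?thesis
    using rank_nullity_mat[OF is_subspace_zero[where 'a='a], of "1\<^sub>m m" m m] by simp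
qed

text \<open>
  Sums of vectors are spelled out entrywise, which is the form in which they arise from
  matrix-vector products.
\<close>

lemma is_subspace_sum:
  assumes W: "is_subspace m W" and "finite F" "\<And>i. i \<in> F \<Longrightarrow> x i \<in> W"
  shows "vec m (\<lambda>a. \<Sum>i\<in>F. x i $ a) \<in> W"
  using assms(2,3)
proof (induction F rule: finite_induct)
  case empty
  have "vec m (\<lambda>a. \<Sum>i\<in>{}. x i $ a) = 0\<^sub>v m" by (intro eq_vecI) auto
  thus ?case using is_subspaceD(2)[OF W] by simp
next
  case (insert k F)
  have "x k \<in> W" using insert by simp
  hence "x k \<in> carrier_vec m" using is_subspaceD(1)[OF W] by auto
  hence "vec m (\<lambda>a. \<Sum>i\<in>insert k F. x i $ a) = x k + vec m (\<lambda>a. \<Sum>i\<in>F. x i $ a)"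
    using insert by (intro eq_vecI) auto
  thus ?case using is_subspaceD(3)[OF W \<open>x k \<in> W\<close>] insert by simp
qed

lemma module_vec_minus:
  assumes "x \<in> carrier_vec m" "y \<in> carrier_vec m"
  shows "x \<ominus>\<^bsub>module_vec TYPE('a::field) m\<^esub> y = x - y"
proof -
  interpret vec_space "TYPE('a)" m .
  show ?thesis using assms unfolding a_minus_def by (auto simp: minus_add_uminus_vec)
qed

lemma is_subspace_mat_kernel:
  fixes A :: "'a::field mat"
  assumes A: "A \<in> carrier_mat m n"
  shows "is_subspace n (mat_kernel A)"
proof -
  have "mat_kernel A = {x \<in> carrier_vec n. A *\<^sub>v x \<in> {0\<^sub>v m}}"
    using mat_kernel[OF A] by auto
  thus ?thesis
    using is_subspace_preimage[OF is_subspace_carrier is_subspace_zero A] by simp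
qed

lemma lin_span_subspace:
  assumes W: "is_subspace m W"
  shows "lin_span m W = W"
proof -
  interpret vec_space "TYPE('a)" m .
  have "span W \<subseteq> W" by (rule span_is_subset[OF subset_refl]) (use W in simp)
  moreover have "W \<subseteq> span W" using in_own_span is_subspaceD(1)[OF W] by simp
  ultimately show ?thesis unfolding lin_span_def by blast
qed

lemma lin_span_cols:
  assumes M: "M \<in> carrier_mat m k"
  shows "lin_span m (set (cols M)) = (*\<^sub>v) M ` carrier_vec k"
proof -
  interpret vec_space "TYPE('a)" m .
  show ?thesis using col_space_eq[OF M] M unfolding col_space_def lin_span_def by auto
qed

section \<open>Row rank and column rank\<close>

lemma subspace_as_mat_image:
  fixes W :: "'a::field vec set"
  assumes W: "is_subspace m W"
  obtains Q where "Q \<in> carrier_mat m (lin_dim m W)" "(*\<^sub>v) Q ` carrier_vec (lin_dim m W) = W"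
proof -
  obtain b where b: "finite b" "b \<subseteq> W" "lin_span m b = W" "card b = lin_dim m W"
    by (rule lin_dim_basis[OF W])
  obtain bs where bs: "set bs = b" "distinct bs" using finite_distinct_list[OF b(1)] by blast
  hence len: "length bs = lin_dim m W" using b(4) distinct_card by fastforce
  define Q where "Q = mat_of_cols m bs"
  have Q: "Q \<in> carrier_mat m (lin_dim m W)" unfolding Q_def using len by auto
  have "cols Q = bs" unfolding Q_def
    by (rule cols_mat_of_cols) (use b(2) bs(1) is_subspaceD(1)[OF W] in auto)
  with lin_span_cols[OF Q] b(3) bs(1) Q that show ?thesis by metis
qed

text \<open>
  If \<open>W\<close> is the column space of \<open>M\<close> and \<open>p\<close> its dimension, then \<open>M = Q X\<close>, where the \<open>p\<close> columns of
  \<open>Q\<close> are a basis of \<open>W\<close>. So \<open>M\<^sup>T = X\<^sup>T Q\<^sup>T\<close> factors through \<open>K\<^sup>p\<close> and has rank at most \<open>p\<close>.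
\<close>

lemma lin_dim_image_transpose_le:
  fixes M :: "'a::field mat"
  assumes M: "M \<in> carrier_mat m k"
  shows "lin_dim k ((*\<^sub>v) M\<^sup>T ` carrier_vec m) \<le> lin_dim m ((*\<^sub>v) M ` carrier_vec k)"
proof -
  define W where "W = (*\<^sub>v) M ` carrier_vec k"
  define p where "p = lin_dim m W"
  have W: "is_subspace m W" unfolding W_def by (rule is_subspace_image[OF is_subspace_carrier M])
  obtain Q where Q: "Q \<in> carrier_mat m p" "(*\<^sub>v) Q ` carrier_vec p = W"
    using subspace_as_mat_image[OF W] unfolding p_def by blast
  have "\<exists>y\<in>carrier_vec p. Q *\<^sub>v y = col M j" if "j < k" for j
  proof -
    have "M *\<^sub>v unit_vec k j \<in> W" unfolding W_def by auto
    moreover have "M *\<^sub>v unit_vec k j = col M j" using M that by (intro eq_vecI) auto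
    ultimately show ?thesis using Q(2) by force
  qed
  then obtain f where f: "\<And>j. j < k \<Longrightarrow> f j \<in> carrier_vec p" "\<And>j. j < k \<Longrightarrow> Q *\<^sub>v f j = col M j"
    by metis
  define X where "X = mat_of_cols p (map f [0..<k])"
  have X: "X \<in> carrier_mat p k" unfolding X_def by auto
  have colX: "col X j = f j" if "j < k" for j
    unfolding X_def using that f(1)[OF that] by (simp add: col_mat_of_cols)
  have "Q * X = M"
  proof (rule mat_col_eqI)
    show "dim_row (Q * X) = dim_row M" "dim_col (Q * X) = dim_col M" using Q X M by auto
    fix j assume "j < dim_col M"
    hence "j < k" using M by simp
    thus "col (Q * X) j = col M j" using col_mult2[OF Q(1) X] colX f(2) by simp
  qed
  hence "M\<^sup>T = X\<^sup>T * Q\<^sup>T" using transpose_mult[OF Q(1) X] by simp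
  hence "M\<^sup>T *\<^sub>v v = X\<^sup>T *\<^sub>v (Q\<^sup>T *\<^sub>v v)" if "v \<in> carrier_vec m" for v
    using that Q X by simp
  hence sub: "(*\<^sub>v) M\<^sup>T ` carrier_vec m \<subseteq> (*\<^sub>v) X\<^sup>T ` carrier_vec p"
    using Q X by auto
  have "lin_dim k ((*\<^sub>v) M\<^sup>T ` carrier_vec m) \<le> lin_dim k ((*\<^sub>v) X\<^sup>T ` carrier_vec p)"
    by (rule lin_dim_mono[OF _ _ sub]; rule is_subspace_image[OF is_subspace_carrier])
      (use M X in auto)
  also have "\<dots> \<le> lin_dim p (carrier_vec p :: 'a vec set)"
    using rank_nullity_mat[OF is_subspace_carrier, of "X\<^sup>T" k p] X by simp
  finally show ?thesis unfolding lin_dim_carrier p_def W_def .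
qed

lemma lin_dim_image_transpose:
  fixes M :: "'a::field mat"
  assumes M: "M \<in> carrier_mat m k"
  shows "lin_dim k ((*\<^sub>v) M\<^sup>T ` carrier_vec m) = lin_dim m ((*\<^sub>v) M ` carrier_vec k)"
  using lin_dim_image_transpose_le[OF M] lin_dim_image_transpose_le[of "M\<^sup>T" k m] M
  by (intro antisym) simp_all

section \<open>Quotient modules\<close>

context Module.module begin

lemma submodule_abelian_subgroup:
  assumes S: "submodule R S M"
  shows "abelian_subgroup S M"
proof (rule abelian_subgroupI3)
  have inv: "\<ominus>\<^bsub>M\<^esub> x \<in> S" if "x \<in> S" for x
  proof -
    have "x \<in> carrier M" using that S by (auto simp: submodule_def)
    hence "\<ominus>\<^bsub>M\<^esub> x = (\<ominus>\<^bsub>R\<^esub> \<one>\<^bsub>R\<^esub>) \<odot>\<^bsub>M\<^esub> x" by (simp add: smult_minus_1)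
    thus ?thesis using that S by (simp add: submodule_def)
  qed
  show "additive_subgroup S M"
  proof (rule additive_subgroupI, rule M.add.subgroupI)
    show "S \<subseteq> carrier M" "S \<noteq> {}" using S by (auto simp: submodule_def)
    show "a \<oplus>\<^bsub>M\<^esub> b \<in> S" if "a \<in> S" "b \<in> S" for a b using that S by (simp add: submodule_def)
  qed (fact inv)
  show "abelian_group M" by (rule M.abelian_group_axioms)
qed

lemma coset_eq_self_iff:
  assumes S: "submodule R S M" and x: "x \<in> carrier M"
  shows "S +>\<^bsub>M\<^esub> x = S \<longleftrightarrow> x \<in> S"
proof -
  interpret S: abelian_subgroup S M by (rule submodule_abelian_subgroup[OF S])
  show ?thesis using S.a_subgroup M.a_coset_join1 M.a_coset_join2 x by blast
qed

text \<open>
  The scalar multiple of a coset is defined as a union over its representatives; all of them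
  contribute the same coset.
\<close>

lemma quotient_space_smult:
  assumes S: "submodule R S M" and c: "c \<in> carrier R" and x: "x \<in> carrier M"
  shows "c \<odot>\<^bsub>quotient_space M S\<^esub> (S +>\<^bsub>M\<^esub> x) = S +>\<^bsub>M\<^esub> (c \<odot>\<^bsub>M\<^esub> x)"
proof -
  interpret S: abelian_subgroup S M by (rule submodule_abelian_subgroup[OF S])
  have SM: "S \<subseteq> carrier M" by (rule S.a_subset)
  have "S +>\<^bsub>M\<^esub> (c \<odot>\<^bsub>M\<^esub> y) = S +>\<^bsub>M\<^esub> (c \<odot>\<^bsub>M\<^esub> x)" if y: "y \<in> S +>\<^bsub>M\<^esub> x" for y
  proof -
    obtain s where s: "s \<in> S" "y = s \<oplus>\<^bsub>M\<^esub> x" using y unfolding a_r_coset_def' by auto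
    have "c \<odot>\<^bsub>M\<^esub> y = (c \<odot>\<^bsub>M\<^esub> s) \<oplus>\<^bsub>M\<^esub> (c \<odot>\<^bsub>M\<^esub> x)"
      unfolding s(2) by (rule smult_r_distr) (use s c x SM in auto)
    moreover have "c \<odot>\<^bsub>M\<^esub> s \<in> S" using S s(1) c by (simp add: submodule_def)
    ultimately have "c \<odot>\<^bsub>M\<^esub> y \<in> S +>\<^bsub>M\<^esub> (c \<odot>\<^bsub>M\<^esub> x)" unfolding a_r_coset_def' by auto
    from M.a_repr_independence[OF this _ S.a_subgroup] c x show ?thesis by simp
  qed
  hence "(\<Union>y\<in>S +>\<^bsub>M\<^esub> x. S +>\<^bsub>M\<^esub> (c \<odot>\<^bsub>M\<^esub> y)) = (\<Union>y\<in>S +>\<^bsub>M\<^esub> x. S +>\<^bsub>M\<^esub> (c \<odot>\<^bsub>M\<^esub> x))"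
    by (rule SUP_cong[OF refl])
  also have "\<dots> = S +>\<^bsub>M\<^esub> (c \<odot>\<^bsub>M\<^esub> x)" using S.a_rcos_self[OF x] by blast
  finally show ?thesis unfolding quotient_space_def by simp
qed

lemma quotient_space_carrier:
  "carrier (quotient_space M S) = (\<lambda>x. S +>\<^bsub>M\<^esub> x) ` carrier M"
  unfolding quotient_space_def A_RCOSETS_def' by auto

lemma quotient_space_add:
  assumes S: "submodule R S M" and "x \<in> carrier M" "y \<in> carrier M"
  shows "(S +>\<^bsub>M\<^esub> x) \<oplus>\<^bsub>quotient_space M S\<^esub> (S +>\<^bsub>M\<^esub> y) = S +>\<^bsub>M\<^esub> (x \<oplus>\<^bsub>M\<^esub> y)"
proof -
  interpret S: abelian_subgroup S M by (rule submodule_abelian_subgroup[OF S])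
  show ?thesis using S.a_rcos_sum assms by (simp add: quotient_space_def)
qed

lemma quotient_space_module:
  assumes S: "submodule R S M"
  shows "Module.module R (quotient_space M S)"
proof -
  interpret S: abelian_subgroup S M by (rule submodule_abelian_subgroup[OF S])
  let ?Q = "quotient_space M S"
  interpret F: comm_group "M A_Mod S" by (rule S.a_factorgroup_is_comm_group)
  have eqs: "carrier (add_monoid ?Q) = carrier (M A_Mod S)"
    "mult (add_monoid ?Q) = mult (M A_Mod S)" "one (add_monoid ?Q) = one (M A_Mod S)"
    by (simp_all add: quotient_space_def A_FactGroup_def')
  have cg: "comm_group (add_monoid ?Q)"
  proof (rule comm_groupI, unfold eqs)
    show "\<exists>y\<in>carrier (M A_Mod S). y \<otimes>\<^bsub>M A_Mod S\<^esub> x = \<one>\<^bsub>M A_Mod S\<^esub>"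
      if "x \<in> carrier (M A_Mod S)" for x using F.l_inv_ex[OF that] .
  qed (fact F.m_closed F.one_closed F.m_assoc F.m_comm F.l_one)+
  have "abelian_group ?Q"
    using cg by (intro abelian_group.intro abelian_monoid.intro abelian_group_axioms.intro)
      (simp_all only: comm_group_def)
  moreover have "module_axioms R ?Q"
    unfolding module_axioms_def
    by (auto simp: quotient_space_carrier quotient_space_smult[OF S] quotient_space_add[OF S]
        smult_l_distr smult_r_distr smult_assoc1)
  ultimately show ?thesis unfolding Module.module_def using R.is_cring by simp
qed

lemma quotient_space_proj:
  assumes S: "submodule R S M"
  shows "mod_hom R M (quotient_space M S) (\<lambda>x. S +>\<^bsub>M\<^esub> x)"
  unfolding mod_hom_def mod_hom_axioms_def LinearCombinations.module_hom_def
  using module_axioms quotient_space_module[OF S]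
  by (auto simp: quotient_space_carrier quotient_space_smult[OF S] quotient_space_add[OF S])

end

context mod_hom begin

text \<open>
  Both inclusions follow from minimality of spans: the preimage of a submodule and the image of a
  submodule are submodules.
\<close>

lemma image_span:
  assumes X: "X \<subseteq> carrier M"
  shows "f ` M.span X = N.span (f ` X)"
proof
  have fX: "f ` X \<subseteq> carrier N" using X by auto
  have sN: "submodule R (N.span (f ` X)) N" by (rule N.span_is_submodule[OF fX])
  have sM: "submodule R (M.span X) M" by (rule M.span_is_submodule[OF X])
  have "submodule R {x \<in> carrier M. f x \<in> N.span (f ` X)} M"
    using sN M.module_axioms unfolding submodule_def by auto
  moreover have "X \<subseteq> {x \<in> carrier M. f x \<in> N.span (f ` X)}" using X N.in_own_span[OF fX] by auto
  ultimately show "f ` M.span X \<subseteq> N.span (f ` X)" using M.span_is_subset by blast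
  have sMc: "M.span X \<subseteq> carrier M" by (rule M.span_is_subset2[OF X])
  have "submodule R (f ` M.span X) N"
  proof (rule submodule.intro)
    show "Module.module R N" by (rule N.module_axioms)
    show "f ` M.span X \<subseteq> carrier N" using sMc by auto
    show "\<zero>\<^bsub>N\<^esub> \<in> f ` M.span X" using sM f0_is_0 by (metis imageI submodule.zero_closed)
    show "v \<oplus>\<^bsub>N\<^esub> w \<in> f ` M.span X" if "v \<in> f ` M.span X" "w \<in> f ` M.span X" for v w
    proof -
      from that obtain a b where ab: "a \<in> M.span X" "v = f a" "b \<in> M.span X" "w = f b" by blast
      hence "v \<oplus>\<^bsub>N\<^esub> w = f (a \<oplus>\<^bsub>M\<^esub> b)" using sMc by (simp add: subset_iff)
      thus ?thesis using submodule.m_closed[OF sM ab(1,3)] by blast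
    qed
    show "c \<odot>\<^bsub>N\<^esub> v \<in> f ` M.span X" if "c \<in> carrier R" "v \<in> f ` M.span X" for c v
    proof -
      from that obtain a where a: "a \<in> M.span X" "v = f a" by blast
      hence "c \<odot>\<^bsub>N\<^esub> v = f (c \<odot>\<^bsub>M\<^esub> a)" using sMc that by (simp add: subset_iff)
      thus ?thesis using submodule.smult_closed[OF sM that(1) a(1)] by blast
    qed
  qed
  moreover have "f ` X \<subseteq> f ` M.span X" using M.in_own_span[OF X] by auto
  ultimately show "N.span (f ` X) \<subseteq> f ` M.span X" by (rule N.span_is_subset[rotated])
qed

lemma hom_finsum:
  assumes "finite A" "u \<in> A \<rightarrow> carrier M"
  shows "f (finsum M u A) = finsum N (\<lambda>j. f (u j)) A"
  using assms
proof (induction A rule: finite_induct)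
  case (insert a A)
  moreover have "(\<lambda>j. f (u j)) \<in> A \<rightarrow> carrier N" "f (u a) \<in> carrier N"
    using insert.prems by auto
  ultimately show ?case by (simp add: M.M.finsum_insert N.M.finsum_insert)
qed simp

end

section \<open>Joins in a quotient\<close>

lemma difference_span_quotient:
  fixes V :: "('a::field, 'v, 'm) module_scheme"
  assumes V: "Module.module class_ring V" and S: "submodule class_ring S V"
    and v: "\<And>i. i \<in> I \<Longrightarrow> v i \<in> carrier V"
  shows "difference_span (quotient_space V S) (\<lambda>i. S +>\<^bsub>V\<^esub> v i) I =
    (\<lambda>x. S +>\<^bsub>V\<^esub> x) ` difference_span V v I"
proof -
  interpret V: Module.module class_ring V by fact
  interpret p: mod_hom class_ring V "quotient_space V S" "\<lambda>x. S +>\<^bsub>V\<^esub> x"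
    by (rule V.quotient_space_proj[OF S])
  have sub: "{v i \<ominus>\<^bsub>V\<^esub> v k | i k. i \<in> I \<and> k \<in> I} \<subseteq> carrier V" using v by auto
  have "{(S +>\<^bsub>V\<^esub> v i) \<ominus>\<^bsub>quotient_space V S\<^esub> (S +>\<^bsub>V\<^esub> v k) | i k. i \<in> I \<and> k \<in> I}
    = (\<lambda>x. S +>\<^bsub>V\<^esub> x) ` {v i \<ominus>\<^bsub>V\<^esub> v k | i k. i \<in> I \<and> k \<in> I}"
    using v by (force simp: image_iff)
  thus ?thesis unfolding difference_span_def using p.image_span[OF sub] by simp
qed

lemma (in Module.module) finsum_minus:
  assumes "finite A" "u \<in> A \<rightarrow> carrier M" "v \<in> A \<rightarrow> carrier M"
  shows "finsum M (\<lambda>j. u j \<ominus>\<^bsub>M\<^esub> v j) A = finsum M u A \<ominus>\<^bsub>M\<^esub> finsum M v A"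
  using assms
proof (induction A rule: finite_induct)
  case empty
  show ?case using M.r_neg[OF M.zero_closed] by (simp only: M.finsum_empty a_minus_def)
next
  case (insert a A)
  hence c: "u a \<in> carrier M" "v a \<in> carrier M" "finsum M u A \<in> carrier M" "finsum M v A \<in> carrier M"
    by auto
  have "finsum M (\<lambda>j. u j \<ominus>\<^bsub>M\<^esub> v j) (insert a A) =
      (u a \<ominus>\<^bsub>M\<^esub> v a) \<oplus>\<^bsub>M\<^esub> (finsum M u A \<ominus>\<^bsub>M\<^esub> finsum M v A)"
    using insert by (subst M.finsum_insert) auto
  also have "\<dots> = (u a \<oplus>\<^bsub>M\<^esub> finsum M u A) \<ominus>\<^bsub>M\<^esub> (v a \<oplus>\<^bsub>M\<^esub> finsum M v A)"
    using c by (simp add: a_minus_def M.minus_add M.a_ac)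
  finally show ?case using insert by (simp add: M.finsum_insert)
qed

text \<open>
  When the sum map \<open>(\<Pi> D\<^sub>j) \<rightarrow> V\<close> is onto, the sum map of the quotient is onto as well, so that
  being a join amounts to its injectivity. The images of the \<open>D\<^sub>j\<close> are their projections
  (\<open>difference_span_quotient\<close>); lifting a tuple in the kernel to representatives gives the
  criterion.
\<close>

lemma is_join_quotient_iff:
  fixes V :: "('a::field, 'v, 'm) module_scheme"
  assumes V: "Module.module class_ring V" and S: "submodule class_ring S V"
    and v: "\<And>i j. j \<le> r \<Longrightarrow> i \<in> part n g j \<Longrightarrow> v i \<in> carrier V"
    and surj: "\<And>x. x \<in> carrier V \<Longrightarrow>
      \<exists>u \<in> (\<Pi> j\<in>{..r}. difference_span V v (part n g j)). finsum V u {..r} = x"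
  shows "is_join (quotient_space V S) r n g (\<lambda>i. S +>\<^bsub>V\<^esub> v i) \<longleftrightarrow>
    (\<forall>u \<in> (\<Pi> j\<in>{..r}. difference_span V v (part n g j)).
       finsum V u {..r} \<in> S \<longrightarrow> (\<forall>j\<le>r. u j \<in> S))"
    (is "?join \<longleftrightarrow> ?crit")
proof -
  interpret V: Module.module class_ring V by fact
  define Q where "Q = quotient_space V S"
  define p where "p = (\<lambda>x. S +>\<^bsub>V\<^esub> x)"
  define D where "D j = difference_span V v (part n g j)" for j
  interpret p: mod_hom class_ring V Q p
    unfolding p_def Q_def by (rule V.quotient_space_proj[OF S])
  have pS: "p x = S \<longleftrightarrow> x \<in> S" if "x \<in> carrier V" for x
    unfolding p_def by (rule V.coset_eq_self_iff[OF S that])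
  have zQ: "\<zero>\<^bsub>Q\<^esub> = S" unfolding Q_def quotient_space_def by simp
  have DQ: "difference_span Q (\<lambda>i. p (v i)) (part n g j) = p ` D j" if "j \<le> r" for j
    unfolding Q_def p_def D_def by (rule difference_span_quotient[OF V S v[OF that]])
  have Dsub: "submodule class_ring (D j) V" if "j \<le> r" for j
    unfolding D_def difference_span_def by (rule V.span_is_submodule) (use v[OF that] in auto)
  have DV: "D j \<subseteq> carrier V" if "j \<le> r" for j
    using Dsub[OF that] by (auto simp: submodule_def)
  have join: "?join \<longleftrightarrow> bij_betw (\<lambda>u. finsum Q u {..r}) (\<Pi>\<^sub>E j\<in>{..r}. p ` D j) (carrier Q)"
  proof -
    have "(\<Pi>\<^sub>E j\<in>{..r}. difference_span Q (\<lambda>i. p (v i)) (part n g j)) = (\<Pi>\<^sub>E j\<in>{..r}. p ` D j)"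
      by (rule PiE_cong) (simp add: DQ)
    thus ?thesis unfolding is_join_def Q_def p_def by simp
  qed
  have PiV: "u \<in> {..r} \<rightarrow> carrier V" if "u \<in> (\<Pi> j\<in>{..r}. D j)" for u
    using that DV by fastforce
  have sum_p: "finsum Q (\<lambda>j\<in>{..r}. p (u j)) {..r} = p (finsum V u {..r})"
    if u: "u \<in> (\<Pi> j\<in>{..r}. D j)" for u
  proof -
    have "p (finsum V u {..r}) = finsum Q (\<lambda>j. p (u j)) {..r}"
      by (rule p.hom_finsum[OF _ PiV[OF u]]) simp
    also have "\<dots> = finsum Q (\<lambda>j\<in>{..r}. p (u j)) {..r}"
      by (rule p.N.M.finsum_cong') (use PiV[OF u] in auto)
    finally show ?thesis by simp
  qed
  have rep: "\<exists>u\<in>(\<Pi> j\<in>{..r}. D j). U = (\<lambda>j\<in>{..r}. p (u j))" if U: "U \<in> (\<Pi>\<^sub>E j\<in>{..r}. p ` D j)" for U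
  proof -
    have "\<forall>j\<in>{..r}. \<exists>x. x \<in> D j \<and> U j = p x" using U by (auto dest!: PiE_mem)
    then obtain u where u: "\<forall>j\<in>{..r}. u j \<in> D j \<and> U j = p (u j)" by metis
    hence "U = (\<lambda>j\<in>{..r}. p (u j))"
      using U by (intro ext) (auto simp: restrict_def PiE_def extensional_def)
    thus ?thesis using u by (intro bexI[of _ u]) auto
  qed
  have "?crit" if j: "?join"
  proof (intro ballI impI allI)
    fix u j assume u: "u \<in> (\<Pi> j\<in>{..r}. difference_span V v (part n g j))"
      and s: "finsum V u {..r} \<in> S" and jr: "j \<le> r"
    have u': "u \<in> (\<Pi> j\<in>{..r}. D j)" using u unfolding D_def .
    let ?z = "\<lambda>_. \<zero>\<^bsub>V\<^esub>"
    have z: "?z \<in> (\<Pi> j\<in>{..r}. D j)" using Dsub by (auto simp: submodule_def)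
    have "finsum V ?z {..r} \<in> S" using S by (simp add: submodule_def)
    hence "p (finsum V u {..r}) = p (finsum V ?z {..r})"
      using s pS V.finsum_closed[OF PiV[OF u']] V.finsum_closed[OF PiV[OF z]] by metis
    hence "finsum Q (\<lambda>j\<in>{..r}. p (u j)) {..r} = finsum Q (\<lambda>j\<in>{..r}. p (?z j)) {..r}"
      using sum_p[OF u'] sum_p[OF z] by simp
    moreover have "(\<lambda>j\<in>{..r}. p (u j)) \<in> (\<Pi>\<^sub>E j\<in>{..r}. p ` D j)" using u' by auto
    moreover have "(\<lambda>j\<in>{..r}. p (?z j)) \<in> (\<Pi>\<^sub>E j\<in>{..r}. p ` D j)"
      unfolding restrict_PiE_iff using z by (blast intro: imageI)
    moreover have "inj_on (\<lambda>u. finsum Q u {..r}) (\<Pi>\<^sub>E j\<in>{..r}. p ` D j)"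
      using j unfolding join bij_betw_def by blast
    ultimately have "(\<lambda>j\<in>{..r}. p (u j)) = (\<lambda>j\<in>{..r}. p (?z j))" by (simp add: inj_on_def)
    hence "p (u j) = p \<zero>\<^bsub>V\<^esub>" using jr by (metis atMost_iff restrict_apply')
    also have "\<dots> = S" using zQ by simp
    finally show "u j \<in> S" using pS PiV[OF u'] jr by auto
  qed
  moreover have "?join" if c: "?crit"
    unfolding join bij_betw_def
  proof
    show "inj_on (\<lambda>u. finsum Q u {..r}) (\<Pi>\<^sub>E j\<in>{..r}. p ` D j)"
    proof (rule inj_onI)
      fix U U' assume U: "U \<in> (\<Pi>\<^sub>E j\<in>{..r}. p ` D j)" and U': "U' \<in> (\<Pi>\<^sub>E j\<in>{..r}. p ` D j)"
        and eq: "finsum Q U {..r} = finsum Q U' {..r}"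
      obtain u where u: "u \<in> (\<Pi> j\<in>{..r}. D j)" "U = (\<lambda>j\<in>{..r}. p (u j))" using rep[OF U] by blast
      obtain u' where u': "u' \<in> (\<Pi> j\<in>{..r}. D j)" "U' = (\<lambda>j\<in>{..r}. p (u' j))" using rep[OF U'] by blast
      note uV = PiV[OF u(1)] and u'V = PiV[OF u'(1)]
      let ?w = "\<lambda>j. u j \<ominus>\<^bsub>V\<^esub> u' j"
      have w: "?w \<in> (\<Pi> j\<in>{..r}. D j)"
      proof
        fix j assume "j \<in> {..r}"
        hence j: "j \<le> r" "u j \<in> D j" "u' j \<in> D j" using u(1) u'(1) by auto
        interpret Dj: abelian_subgroup "D j" V by (rule V.submodule_abelian_subgroup[OF Dsub[OF j(1)]])
        show "?w j \<in> D j" unfolding a_minus_def using j by simp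
      qed
      have "p (finsum V ?w {..r}) = p (finsum V u {..r}) \<ominus>\<^bsub>Q\<^esub> p (finsum V u' {..r})"
        using V.finsum_minus[OF _ uV u'V] V.finsum_closed[OF uV] V.finsum_closed[OF u'V] by simp
      also have "p (finsum V u {..r}) = p (finsum V u' {..r})"
        using eq sum_p[OF u(1)] sum_p[OF u'(1)] u(2) u'(2) by simp
      also have "p (finsum V u' {..r}) \<ominus>\<^bsub>Q\<^esub> p (finsum V u' {..r}) = S"
        using zQ V.finsum_closed[OF u'V] by (simp add: a_minus_def p.N.M.r_neg)
      finally have "finsum V ?w {..r} \<in> S" using pS V.finsum_closed[OF PiV[OF w]] by blast
      hence wS: "?w j \<in> S" if "j \<le> r" for j using c w that unfolding D_def by blast
      have "p (u j) = p (u' j)" if j: "j \<le> r" for j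
      proof -
        have cj: "u j \<in> carrier V" "u' j \<in> carrier V" using uV u'V j by auto
        have "p (u j) \<ominus>\<^bsub>Q\<^esub> p (u' j) = \<zero>\<^bsub>Q\<^esub>"
          using wS[OF j] pS[of "?w j"] cj zQ by simp
        thus ?thesis using cj by (simp add: p.N.M.minus_other_side)
      qed
      thus "U = U'" unfolding u(2) u'(2) by (intro ext) (auto simp: restrict_def)
    qed
    show "(\<lambda>u. finsum Q u {..r}) ` (\<Pi>\<^sub>E j\<in>{..r}. p ` D j) = carrier Q"
    proof
      show "(\<lambda>u. finsum Q u {..r}) ` (\<Pi>\<^sub>E j\<in>{..r}. p ` D j) \<subseteq> carrier Q"
      proof (rule image_subsetI)
        fix U assume "U \<in> (\<Pi>\<^sub>E j\<in>{..r}. p ` D j)"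
        then obtain u where u: "u \<in> (\<Pi> j\<in>{..r}. D j)" "U = (\<lambda>j\<in>{..r}. p (u j))" using rep by blast
        show "finsum Q U {..r} \<in> carrier Q"
          unfolding u(2) sum_p[OF u(1)] using V.finsum_closed[OF PiV[OF u(1)]] by simp
      qed
      show "carrier Q \<subseteq> (\<lambda>u. finsum Q u {..r}) ` (\<Pi>\<^sub>E j\<in>{..r}. p ` D j)"
      proof
        fix X assume "X \<in> carrier Q"
        then obtain x where x: "x \<in> carrier V" "X = p x"
          unfolding Q_def p_def V.quotient_space_carrier by blast
        obtain u where u: "u \<in> (\<Pi> j\<in>{..r}. D j)" "finsum V u {..r} = x"
          using surj[OF x(1)] unfolding D_def by blast
        have "X = finsum Q (\<lambda>j\<in>{..r}. p (u j)) {..r}" using sum_p[OF u(1)] u(2) x(2) by simp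
        moreover have "(\<lambda>j\<in>{..r}. p (u j)) \<in> (\<Pi>\<^sub>E j\<in>{..r}. p ` D j)" using u(1) by auto
        ultimately show "X \<in> (\<lambda>u. finsum Q u {..r}) ` (\<Pi>\<^sub>E j\<in>{..r}. p ` D j)" by blast
      qed
    qed
  qed
  ultimately show ?thesis by blast
qed

section \<open>Direct sums of coordinate projections\<close>

lemma mult_mat_vec_index_sum:
  assumes "M \<in> carrier_mat m n" "l \<in> carrier_vec n" "a < m"
  shows "(M *\<^sub>v l) $ a = (\<Sum>i<n. M $$ (a, i) * l $ i)"
  using assms by (auto simp: scalar_prod_def atLeast0LessThan intro!: sum.cong)

lemma part_subset: "part n g j \<subseteq> {..<n}" and finite_part: "finite (part n g j)"
  unfolding part_def by auto

definition coord_proj :: "nat \<Rightarrow> nat set \<Rightarrow> 'a::field mat" where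
  "coord_proj n I = mat n n (\<lambda>(i, k). if i = k \<and> i \<in> I then 1 else 0)"

lemma coord_proj_carrier [simp]: "coord_proj n I \<in> carrier_mat n n"
  by (simp add: coord_proj_def)

lemma coord_proj_mult:
  assumes v: "v \<in> carrier_vec n"
  shows "coord_proj n I *\<^sub>v v = vec n (\<lambda>i. if i \<in> I then v $ i else 0)"
proof (rule eq_vecI)
  fix i assume i: "i < dim_vec (vec n (\<lambda>i. if i \<in> I then v $ i else 0))"
  have "(coord_proj n I *\<^sub>v v) $ i = (\<Sum>k<n. (coord_proj n I) $$ (i, k) * v $ k)"
    using i v by (intro mult_mat_vec_index_sum[OF coord_proj_carrier]) auto
  also have "\<dots> = (\<Sum>k<n. if k = i then (if i \<in> I then v $ i else 0) else 0)"
    using i by (intro sum.cong) (auto simp: coord_proj_def)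
  finally show "(coord_proj n I *\<^sub>v v) $ i = vec n (\<lambda>i. if i \<in> I then v $ i else 0) $ i"
    using i by simp
qed (simp add: coord_proj_def)

text \<open>
  The direct sum of the images of \<open>N\<close> under the projections to the parts \<open>0, ..., r - 1\<close>. It is
  described by conditions on the coordinates, one for each part, because membership is then checked
  part by part; \<open>block_sum_least\<close> recovers the description as a sum of subspaces.
\<close>

definition block_sum :: "nat \<Rightarrow> (nat \<Rightarrow> nat) \<Rightarrow> nat \<Rightarrow> 'a::field vec set \<Rightarrow> 'a vec set" where
  "block_sum n g r N = {v \<in> carrier_vec n. (\<forall>i<n. r \<le> g i \<longrightarrow> v $ i = 0) \<and>
     (\<forall>j<r. coord_proj n (part n g j) *\<^sub>v v \<in> (*\<^sub>v) (coord_proj n (part n g j)) ` N)}"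

lemma is_subspace_block_sum:
  assumes N: "is_subspace n N"
  shows "is_subspace n (block_sum n g r N)"
proof (rule is_subspaceI)
  have PN: "is_subspace n ((*\<^sub>v) (coord_proj n (part n g j)) ` N)" for j
    by (rule is_subspace_image[OF N]) simp
  show "block_sum n g r N \<subseteq> carrier_vec n" unfolding block_sum_def by auto
  show "0\<^sub>v n \<in> block_sum n g r N"
    using is_subspaceD(2)[OF PN] unfolding block_sum_def
    by (auto simp: mult_mat_zero_vec[OF coord_proj_carrier])
  show "x + y \<in> block_sum n g r N" if "x \<in> block_sum n g r N" "y \<in> block_sum n g r N" for x y
    using that is_subspaceD(3)[OF PN] unfolding block_sum_def
    by (auto simp: mult_add_distrib_mat_vec[OF coord_proj_carrier])
  show "c \<cdot>\<^sub>v x \<in> block_sum n g r N" if "x \<in> block_sum n g r N" for c x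
    using that is_subspaceD(4)[OF PN] unfolding block_sum_def
    by (auto simp: mult_mat_vec[OF coord_proj_carrier])
qed

lemma coord_proj_part_twice:
  assumes "v \<in> carrier_vec n"
  shows "coord_proj n (part n g j) *\<^sub>v (coord_proj n (part n g k) *\<^sub>v v) =
    (if j = k then coord_proj n (part n g j) *\<^sub>v v else 0\<^sub>v n)"
  using assms by (auto simp: coord_proj_mult part_def intro!: eq_vecI)

lemma coord_proj_mem_block_sum:
  assumes N: "is_subspace n N" and u: "u \<in> N" and j: "j < r"
  shows "coord_proj n (part n g j) *\<^sub>v u \<in> block_sum n g r N"
proof -
  have uc: "u \<in> carrier_vec n" using is_subspaceD(1)[OF N] u by auto
  have "coord_proj n (part n g k) *\<^sub>v (coord_proj n (part n g j) *\<^sub>v u) \<in>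
      (*\<^sub>v) (coord_proj n (part n g k)) ` N" for k
  proof (cases "k = j")
    case True
    thus ?thesis using u uc by (simp add: coord_proj_part_twice)
  next
    case False
    have "0\<^sub>v n = coord_proj n (part n g k) *\<^sub>v 0\<^sub>v n"
      by (rule mult_mat_zero_vec[OF coord_proj_carrier, symmetric])
    thus ?thesis using False uc is_subspaceD(2)[OF N] by (auto simp: coord_proj_part_twice)
  qed
  moreover have "(coord_proj n (part n g j) *\<^sub>v u) $ i = 0" if "i < n" "r \<le> g i" for i
    using that j uc by (auto simp: coord_proj_mult part_def)
  moreover have "coord_proj n (part n g j) *\<^sub>v u \<in> carrier_vec n" 
    by (rule mult_mat_vec_carrier[OF coord_proj_carrier uc])
  ultimately show ?thesis unfolding block_sum_def by blast
qed

text \<open>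
  Projecting to part \<open>r\<close> peels off the last summand: together with the reverse inclusion
  \<open>block_sum_subset_kernel\<close> this identifies the kernel of that projection.
\<close>

lemma block_sum_Suc_kernel:
  "{v \<in> block_sum n g (Suc r) N. coord_proj n (part n g r) *\<^sub>v v = 0\<^sub>v n} \<subseteq> block_sum n g r N"
proof
  fix v assume v: "v \<in> {v \<in> block_sum n g (Suc r) N. coord_proj n (part n g r) *\<^sub>v v = 0\<^sub>v n}"
  hence vc: "v \<in> carrier_vec n" unfolding block_sum_def by auto
  have "v $ i = 0" if i: "i < n" "g i = r" for i
  proof -
    have "(coord_proj n (part n g r) *\<^sub>v v) $ i = 0\<^sub>v n $ i" using v by simp
    thus ?thesis using i by (simp add: coord_proj_mult[OF vc] part_def)
  qed
  thus "v \<in> block_sum n g r N" using v unfolding block_sum_def by (auto simp: le_eq_less_or_eq Suc_le_eq)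
qed

lemma block_sum_subset_kernel:
  assumes N: "is_subspace n N"
  shows "block_sum n g r N \<subseteq> {v \<in> block_sum n g (Suc r) N. coord_proj n (part n g r) *\<^sub>v v = 0\<^sub>v n}"
proof
  fix v assume v: "v \<in> block_sum n g r N"
  hence vc: "v \<in> carrier_vec n" unfolding block_sum_def by auto
  have z: "coord_proj n (part n g r) *\<^sub>v v = 0\<^sub>v n"
    using v unfolding coord_proj_mult[OF vc] by (intro eq_vecI) (auto simp: block_sum_def part_def)
  have "0\<^sub>v n = coord_proj n (part n g r) *\<^sub>v 0\<^sub>v n"
    by (rule mult_mat_zero_vec[OF coord_proj_carrier, symmetric])
  hence "coord_proj n (part n g r) *\<^sub>v v \<in> (*\<^sub>v) (coord_proj n (part n g r)) ` N"
    using z is_subspaceD(2)[OF N] by auto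
  thus "v \<in> {v \<in> block_sum n g (Suc r) N. coord_proj n (part n g r) *\<^sub>v v = 0\<^sub>v n}"
    using v z unfolding block_sum_def by (auto simp: less_Suc_eq)
qed

text \<open>
  Induction on \<open>r\<close>: the projection to part \<open>r\<close> maps the sum of the first \<open>r + 1\<close> blocks onto the
  last block, with kernel the sum of the others.
\<close>

lemma lin_dim_block_sum:
  fixes N :: "'a::field vec set"
  assumes N: "is_subspace n N"
  shows "lin_dim n (block_sum n g r N) = (\<Sum>j<r. lin_dim n ((*\<^sub>v) (coord_proj n (part n g j)) ` N))"
proof (induction r)
  case 0
  have "block_sum n g 0 N = {0\<^sub>v n}" unfolding block_sum_def by (auto intro!: eq_vecI)
  thus ?case by (simp add: lin_dim_zero)
next
  case (Suc r)
  let ?P = "coord_proj n (part n g r) :: 'a mat"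
  have im: "(*\<^sub>v) ?P ` block_sum n g (Suc r) N = (*\<^sub>v) ?P ` N"
  proof
    show "(*\<^sub>v) ?P ` block_sum n g (Suc r) N \<subseteq> (*\<^sub>v) ?P ` N" unfolding block_sum_def by auto
    show "(*\<^sub>v) ?P ` N \<subseteq> (*\<^sub>v) ?P ` block_sum n g (Suc r) N"
    proof
      fix x assume "x \<in> (*\<^sub>v) ?P ` N"
      then obtain u where u: "u \<in> N" "x = ?P *\<^sub>v u" by auto
      have "u \<in> carrier_vec n" using is_subspaceD(1)[OF N] u by auto
      hence "x = ?P *\<^sub>v (?P *\<^sub>v u)" by (simp add: coord_proj_part_twice u(2))
      thus "x \<in> (*\<^sub>v) ?P ` block_sum n g (Suc r) N"
        using coord_proj_mem_block_sum[OF N u(1), of r "Suc r" g] by blast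
    qed
  qed
  have ker: "{v \<in> block_sum n g (Suc r) N. ?P *\<^sub>v v = 0\<^sub>v n} = block_sum n g r N"
    using block_sum_Suc_kernel block_sum_subset_kernel[OF N] by (rule equalityI)
  show ?case
    using rank_nullity_mat[OF is_subspace_block_sum[OF N] coord_proj_carrier,
        of g "Suc r" "part n g r"] Suc.IH
    unfolding im ker by simp
qed

text \<open>
  Every element is the sum of its projections to the parts; the induction splits off one of them at
  a time.
\<close>

lemma block_sum_least:
  fixes N :: "'a::field vec set"
  assumes N: "is_subspace n N" and X: "is_subspace n X"
    and PX: "\<And>j u. j < r \<Longrightarrow> u \<in> N \<Longrightarrow> coord_proj n (part n g j) *\<^sub>v u \<in> X"
  shows "block_sum n g r N \<subseteq> X"
  using PX
proof (induction r)
  case 0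
  have "block_sum n g 0 N \<subseteq> {0\<^sub>v n}" unfolding block_sum_def by (auto intro!: eq_vecI)
  thus ?case using is_subspaceD(2)[OF X] by auto
next
  case (Suc r)
  let ?P = "coord_proj n (part n g r) :: 'a mat"
  show ?case
  proof
    fix v assume v: "v \<in> block_sum n g (Suc r) N"
    hence vc: "v \<in> carrier_vec n" unfolding block_sum_def by auto
    have Pvc: "?P *\<^sub>v v \<in> carrier_vec n" by (rule mult_mat_vec_carrier[OF coord_proj_carrier vc])
    obtain u where u: "u \<in> N" "?P *\<^sub>v v = ?P *\<^sub>v u" using v unfolding block_sum_def by auto
    have Pv: "?P *\<^sub>v v \<in> block_sum n g (Suc r) N"
      unfolding u(2) by (rule coord_proj_mem_block_sum[OF N u(1)]) simp
    have "v - ?P *\<^sub>v v \<in> block_sum n g (Suc r) N"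
      by (rule is_subspaceD(5)[OF is_subspace_block_sum[OF N] v Pv])
    moreover have "?P *\<^sub>v (v - ?P *\<^sub>v v) = 0\<^sub>v n"
      using vc Pvc mult_minus_distrib_mat_vec[OF coord_proj_carrier vc Pvc, of "part n g r"]
        mult_mat_vec_carrier[OF coord_proj_carrier vc, of "part n g r"]
      by (simp add: coord_proj_part_twice)
    ultimately have "v - ?P *\<^sub>v v \<in> block_sum n g r N" using block_sum_Suc_kernel by blast
    hence "v - ?P *\<^sub>v v \<in> X" using Suc by auto
    moreover have "?P *\<^sub>v v \<in> X" unfolding u(2) using Suc.prems u(1) by simp
    ultimately have "(v - ?P *\<^sub>v v) + ?P *\<^sub>v v \<in> X" by (rule is_subspaceD(3)[OF X])
    moreover have "(v - ?P *\<^sub>v v) + ?P *\<^sub>v v = v"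
      using vc by (intro eq_vecI) (simp_all add: coord_proj_mult)
    ultimately show "v \<in> X" by simp
  qed
qed

lemma subset_block_sum:
  assumes N: "is_subspace n N" and g: "\<And>i. i < n \<Longrightarrow> g i < r"
  shows "N \<subseteq> block_sum n g r N"
  using is_subspaceD(1)[OF N] g unfolding block_sum_def by fastforce

section \<open>Joins in terms of coefficient vectors\<close>

text \<open>
  The coefficient vectors of combinations of the differences \<open>w i - w k\<close> with \<open>i, k \<in> I\<close>.
\<close>

definition zero_sum_on :: "nat \<Rightarrow> nat set \<Rightarrow> 'a::field vec set" where
  "zero_sum_on n I = {l \<in> carrier_vec n. (\<forall>i<n. i \<notin> I \<longrightarrow> l $ i = 0) \<and> (\<Sum>i\<in>I. l $ i) = 0}"

lemma is_subspace_zero_sum_on: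
  assumes I: "I \<subseteq> {..<n}"
  shows "is_subspace n (zero_sum_on n I :: 'a::field vec set)"
proof (rule is_subspaceI)
  show "x + y \<in> zero_sum_on n I" if "x \<in> zero_sum_on n I" "y \<in> zero_sum_on n I" for x y :: "'a vec"
  proof -
    have "(\<Sum>i\<in>I. (x + y) $ i) = (\<Sum>i\<in>I. x $ i + y $ i)"
      using I that by (intro sum.cong) (auto simp: zero_sum_on_def)
    thus ?thesis using that by (auto simp: zero_sum_on_def sum.distrib)
  qed
  show "c \<cdot>\<^sub>v x \<in> zero_sum_on n I" if "x \<in> zero_sum_on n I" for c and x :: "'a vec"
  proof -
    have "(\<Sum>i\<in>I. (c \<cdot>\<^sub>v x) $ i) = (\<Sum>i\<in>I. c * x $ i)"
      using I that by (intro sum.cong) (auto simp: zero_sum_on_def)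
    thus ?thesis using that by (auto simp: zero_sum_on_def simp flip: sum_distrib_left)
  qed
  have "(\<Sum>i\<in>I. 0\<^sub>v n $ i) = (0::'a)" using I by (intro sum.neutral) auto
  thus "0\<^sub>v n \<in> (zero_sum_on n I :: 'a vec set)" by (simp add: zero_sum_on_def)
qed (auto simp: zero_sum_on_def)

text \<open>
  A difference \<open>w i - w k\<close> has coefficient vector \<open>e\<^sub>i - e\<^sub>k\<close>. Conversely, if the coefficients
  \<open>l\<^sub>i\<close> have sum zero, then \<open>\<Sum>\<^sub>i l\<^sub>i w\<^sub>i = \<Sum>\<^sub>i l\<^sub>i (w\<^sub>i - w\<^sub>k)\<close> for any fixed \<open>k \<in> I\<close>.
\<close>

lemma difference_span_eq_image:
  fixes M :: "'a::field mat"
  assumes M: "M \<in> carrier_mat m n" and I: "I \<subseteq> {..<n}" and w: "\<And>i. i \<in> I \<Longrightarrow> w i = col M i"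
  shows "difference_span (module_vec TYPE('a) m) w I = (*\<^sub>v) M ` zero_sum_on n I"
proof
  interpret vec_space "TYPE('a)" m .
  let ?X = "{w i \<ominus>\<^bsub>V\<^esub> w k | i k. i \<in> I \<and> k \<in> I}"
  have finI: "finite I" using I finite_subset by blast
  have wc: "w i \<in> carrier_vec m" if "i \<in> I" for i
    using w[OF that] that I M by auto
  have X: "?X = {w i - w k | i k. i \<in> I \<and> k \<in> I}"
  proof -
    have "w i \<ominus>\<^bsub>V\<^esub> w k = w i - w k" if "i \<in> I" "k \<in> I" for i k
      by (rule module_vec_minus[OF wc[OF that(1)] wc[OF that(2)]])
    thus ?thesis by (intro Collect_cong) metis
  qed
  have L: "is_subspace n (zero_sum_on n I :: 'a vec set)" by (rule is_subspace_zero_sum_on[OF I])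
  have subW: "is_subspace m ((*\<^sub>v) M ` zero_sum_on n I)" by (rule is_subspace_image[OF L M])
  have Xc: "?X \<subseteq> carrier_vec m" unfolding X using wc by auto
  have D: "is_subspace m (span ?X)" using span_is_subspace Xc by simp
  have "?X \<subseteq> (*\<^sub>v) M ` zero_sum_on n I"
  proof
    fix x assume "x \<in> ?X"
    then obtain i k where ik: "i \<in> I" "k \<in> I" "x = w i - w k" unfolding X by auto
    hence ikn: "i < n" "k < n" using I by auto
    have "x = M *\<^sub>v (unit_vec n i - unit_vec n k)"
      unfolding ik(3) w[OF ik(1)] w[OF ik(2)]
      by (subst mult_minus_distrib_mat_vec[OF M]) (use ikn M in \<open>auto intro!: eq_vecI\<close>)
    moreover have "unit_vec n i - unit_vec n k \<in> (zero_sum_on n I :: 'a vec set)"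
    proof -
      have "(\<Sum>a\<in>I. unit_vec n i $ a) = (1::'a)" if "i \<in> I" for i
      proof -
        have "(\<Sum>a\<in>I. unit_vec n i $ a) = (\<Sum>a\<in>I. if a = i then 1 else (0::'a))"
          using I that by (intro sum.cong) (auto simp: unit_vec_def)
        thus ?thesis using that finI by simp
      qed
      moreover have "(\<Sum>a\<in>I. (unit_vec n i - unit_vec n k) $ a) =
          (\<Sum>a\<in>I. unit_vec n i $ a - (unit_vec n k $ a :: 'a))"
        using I by (intro sum.cong) auto
      ultimately show ?thesis using ik ikn
        unfolding zero_sum_on_def by (auto simp: sum_subtractf)
    qed
    ultimately show "x \<in> (*\<^sub>v) M ` zero_sum_on n I" by blast
  qed
  thus "difference_span V w I \<subseteq> (*\<^sub>v) M ` zero_sum_on n I"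
    unfolding difference_span_def by (rule span_is_subset) (use subW in simp)
  show "(*\<^sub>v) M ` zero_sum_on n I \<subseteq> difference_span V w I"
  proof
    fix x assume "x \<in> (*\<^sub>v) M ` zero_sum_on n I"
    then obtain l where l: "l \<in> zero_sum_on n I" "x = M *\<^sub>v l" by auto
    have lc: "l \<in> carrier_vec n" and l0: "\<And>i. i < n \<Longrightarrow> i \<notin> I \<Longrightarrow> l $ i = 0" and ls: "(\<Sum>i\<in>I. l $ i) = 0"
      using l(1) unfolding zero_sum_on_def by auto
    have Ml: "(M *\<^sub>v l) $ a = (\<Sum>i\<in>I. M $$ (a, i) * l $ i)" if "a < m" for a
      unfolding mult_mat_vec_index_sum[OF M lc that]
      by (rule sum.mono_neutral_right) (use I l0 in auto)
    have "x = vec m (\<lambda>a. \<Sum>i\<in>I. (l $ i \<cdot>\<^sub>v (w i - w k)) $ a)" if k: "k \<in> I" for k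
    proof (rule eq_vecI)
      fix a assume "a < dim_vec (vec m (\<lambda>a. \<Sum>i\<in>I. (l $ i \<cdot>\<^sub>v (w i - w k)) $ a))"
      hence a: "a < m" by simp
      have "(\<Sum>i\<in>I. (l $ i \<cdot>\<^sub>v (w i - w k)) $ a) = (\<Sum>i\<in>I. M $$ (a, i) * l $ i - M $$ (a, k) * l $ i)"
        using a w wc k M I by (intro sum.cong) (auto simp: algebra_simps subset_iff)
      also have "\<dots> = (\<Sum>i\<in>I. M $$ (a, i) * l $ i) - M $$ (a, k) * (\<Sum>i\<in>I. l $ i)"
        by (simp add: sum_subtractf sum_distrib_left)
      finally show "x $ a = vec m (\<lambda>a. \<Sum>i\<in>I. (l $ i \<cdot>\<^sub>v (w i - w k)) $ a) $ a"
        using Ml[OF a] ls l(2) a by simp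
    qed (use l(2) M in auto)
    moreover have "vec m (\<lambda>a. \<Sum>i\<in>I. (l $ i \<cdot>\<^sub>v (w i - w k)) $ a) \<in> span ?X" if k: "k \<in> I" for k
    proof (rule is_subspace_sum[OF D finI])
      fix i assume "i \<in> I"
      hence "w i - w k \<in> ?X" unfolding X using k by blast
      hence "w i - w k \<in> span ?X" using in_own_span[of ?X] Xc by auto
      thus "l $ i \<cdot>\<^sub>v (w i - w k) \<in> span ?X" by (rule is_subspaceD(4)[OF D])
    qed
    moreover have "x \<in> span ?X" if "I = {}"
    proof -
      have "x = 0\<^sub>v m" using that Ml l(2) M by (intro eq_vecI) auto
      thus ?thesis using is_subspaceD(2)[OF D] by simp
    qed
    ultimately show "x \<in> difference_span V w I" unfolding difference_span_def by (cases "I = {}") auto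
  qed
qed

text \<open>
  When every index belongs to one of the parts \<open>0, ..., r\<close>, this is the direct sum of the spaces of
  zero-sum vectors on the parts (\<open>coord_proj_balanced\<close>, \<open>glue_zero_sum\<close>), so that a balanced vector
  provides coefficients for one element of each difference span.
\<close>

definition balanced :: "nat \<Rightarrow> (nat \<Rightarrow> nat) \<Rightarrow> nat \<Rightarrow> 'a::field vec set" where
  "balanced n g r = {l \<in> carrier_vec n. \<forall>j\<le>r. (\<Sum>i\<in>part n g j. l $ i) = 0}"

lemma is_subspace_balanced: "is_subspace n (balanced n g r :: 'a::field vec set)"
proof (rule is_subspaceI)
  show "x + y \<in> balanced n g r" if "x \<in> balanced n g r" "y \<in> balanced n g r" for x y :: "'a vec"
  proof -
    have "(\<Sum>i\<in>part n g j. (x + y) $ i) = (\<Sum>i\<in>part n g j. x $ i + y $ i)" for j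
      using that by (intro sum.cong) (auto simp: balanced_def part_def)
    thus ?thesis using that by (auto simp: balanced_def sum.distrib)
  qed
  show "c \<cdot>\<^sub>v x \<in> balanced n g r" if "x \<in> balanced n g r" for c and x :: "'a vec"
  proof -
    have "(\<Sum>i\<in>part n g j. (c \<cdot>\<^sub>v x) $ i) = (\<Sum>i\<in>part n g j. c * x $ i)" for j
      using that by (intro sum.cong) (auto simp: balanced_def part_def)
    thus ?thesis using that by (auto simp: balanced_def simp flip: sum_distrib_left)
  qed
  have "(\<Sum>i\<in>part n g j. 0\<^sub>v n $ i) = (0::'a)" for j by (intro sum.neutral) (auto simp: part_def)
  thus "0\<^sub>v n \<in> (balanced n g r :: 'a vec set)" by (simp add: balanced_def)
qed (auto simp: balanced_def)

lemma zero_sum_on_part_balanced: "zero_sum_on n (part n g j) \<subseteq> balanced n g r"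
proof
  fix l :: "'a::field vec" assume l: "l \<in> zero_sum_on n (part n g j)"
  have "(\<Sum>i\<in>part n g k. l $ i) = 0" for k
  proof (cases "k = j")
    case False
    thus ?thesis using l by (intro sum.neutral) (auto simp: zero_sum_on_def part_def)
  qed (use l in \<open>simp add: zero_sum_on_def\<close>)
  thus "l \<in> balanced n g r" using l by (simp add: zero_sum_on_def balanced_def)
qed

lemma coord_proj_balanced:
  assumes l: "l \<in> balanced n g r" and j: "j \<le> r"
  shows "coord_proj n (part n g j) *\<^sub>v l \<in> zero_sum_on n (part n g j)"
proof -
  have lc: "l \<in> carrier_vec n" using l by (simp add: balanced_def)
  have "(\<Sum>i\<in>part n g j. (coord_proj n (part n g j) *\<^sub>v l) $ i) = (\<Sum>i\<in>part n g j. l $ i)"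
    by (rule sum.cong) (auto simp: coord_proj_mult[OF lc] part_def)
  thus ?thesis using l j unfolding zero_sum_on_def
    by (auto simp: balanced_def coord_proj_mult)
qed

lemma glue_zero_sum:
  assumes "\<And>j. j \<le> r \<Longrightarrow> l j \<in> zero_sum_on n (part n g j)"
  obtains l' where "l' \<in> balanced n g r" "\<And>j. j \<le> r \<Longrightarrow> coord_proj n (part n g j) *\<^sub>v l' = l j"
proof
  let ?l = "vec n (\<lambda>i. l (g i) $ i)"
  show "?l \<in> balanced n g r"
    unfolding balanced_def
  proof (intro CollectI conjI allI impI)
    fix j assume j: "j \<le> r"
    have "(\<Sum>i\<in>part n g j. ?l $ i) = (\<Sum>i\<in>part n g j. l j $ i)"
      by (rule sum.cong) (auto simp: part_def)
    thus "(\<Sum>i\<in>part n g j. ?l $ i) = 0" using assms[OF j] by (simp add: zero_sum_on_def)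
  qed simp
  show "coord_proj n (part n g j) *\<^sub>v ?l = l j" if "j \<le> r" for j
    using assms[OF that] by (auto simp: coord_proj_mult zero_sum_on_def part_def intro!: eq_vecI)
qed

lemma finsum_coord_proj:
  fixes M :: "'a::field mat"
  assumes M: "M \<in> carrier_mat m n" and l: "l \<in> carrier_vec n" and g: "\<And>i. i < n \<Longrightarrow> g i \<le> r"
  shows "finsum (module_vec TYPE('a) m) (\<lambda>j. M *\<^sub>v (coord_proj n (part n g j) *\<^sub>v l)) {..r} = M *\<^sub>v l"
proof -
  interpret vec_space "TYPE('a)" m .
  let ?P = "\<lambda>j. coord_proj n (part n g j) :: 'a mat"
  have Pc: "?P j *\<^sub>v l \<in> carrier_vec n" for j by (rule mult_mat_vec_carrier[OF coord_proj_carrier l])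
  have c: "(\<lambda>j. M *\<^sub>v (?P j *\<^sub>v l)) \<in> {..r} \<rightarrow> carrier_vec m"
    using mult_mat_vec_carrier[OF M Pc] by auto
  show ?thesis
  proof (rule eq_vecI)
    show "dim_vec (finsum V (\<lambda>j. M *\<^sub>v (?P j *\<^sub>v l)) {..r}) = dim_vec (M *\<^sub>v l)"
      using finsum_closed[OF c] M by simp
    fix a assume "a < dim_vec (M *\<^sub>v l)"
    hence a: "a < m" using M by simp
    have "finsum V (\<lambda>j. M *\<^sub>v (?P j *\<^sub>v l)) {..r} $ a = (\<Sum>j\<le>r. (M *\<^sub>v (?P j *\<^sub>v l)) $ a)"
      using index_finsum_vec[OF _ a c] unfolding finsum_vec by simp
    also have "\<dots> = (\<Sum>j\<le>r. \<Sum>i<n. M $$ (a, i) * (?P j *\<^sub>v l) $ i)"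
      by (simp only: mult_mat_vec_index_sum[OF M Pc a])
    also have "\<dots> = (\<Sum>i<n. \<Sum>j\<le>r. M $$ (a, i) * (?P j *\<^sub>v l) $ i)" by (rule sum.swap)
    also have "\<dots> = (\<Sum>i<n. \<Sum>j\<le>r. if j = g i then M $$ (a, i) * l $ i else 0)"
      by (intro sum.cong refl) (auto simp: coord_proj_mult[OF l] part_def)
    also have "\<dots> = (\<Sum>i<n. M $$ (a, i) * l $ i)"
      using g by (intro sum.cong) auto
    also have "\<dots> = (M *\<^sub>v l) $ a" by (rule mult_mat_vec_index_sum[OF M l a, symmetric])
    finally show "finsum V (\<lambda>j. M *\<^sub>v (?P j *\<^sub>v l)) {..r} $ a = (M *\<^sub>v l) $ a" .
  qed
qed

text \<open>
  The criterion \<open>is_join_quotient_iff\<close> in terms of coefficients: a tuple of elements of the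
  difference spans comes from a balanced vector \<open>l\<close>, its components are the \<open>M (P\<^sub>j l)\<close> and its sum
  is \<open>M l\<close>.
\<close>

lemma is_join_quotient_coeff:
  fixes M :: "'a::field mat"
  assumes S: "is_subspace m S" and M: "M \<in> carrier_mat m n"
    and w: "\<And>i. i < n \<Longrightarrow> w i = col M i" and g: "\<And>i. i < n \<Longrightarrow> g i \<le> r"
    and surj: "(*\<^sub>v) M ` balanced n g r = carrier_vec m"
  shows "is_join (quotient_space (module_vec TYPE('a) m) S) r n g
      (\<lambda>i. S +>\<^bsub>module_vec TYPE('a) m\<^esub> w i) \<longleftrightarrow>
    (\<forall>l \<in> balanced n g r. M *\<^sub>v l \<in> S \<longrightarrow> (\<forall>j\<le>r. M *\<^sub>v (coord_proj n (part n g j) *\<^sub>v l) \<in> S))"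
    (is "?join \<longleftrightarrow> ?crit")
proof -
  interpret vec_space "TYPE('a)" m .
  let ?P = "\<lambda>j. coord_proj n (part n g j) :: 'a mat"
  define D where "D j = difference_span V w (part n g j)" for j
  have D: "D j = (*\<^sub>v) M ` zero_sum_on n (part n g j)" for j
    unfolding D_def by (rule difference_span_eq_image[OF M part_subset]) (auto simp: w part_def)
  have to_D: "(\<lambda>j. M *\<^sub>v (?P j *\<^sub>v l)) \<in> (\<Pi> j\<in>{..r}. D j)" if "l \<in> balanced n g r" for l
    using coord_proj_balanced[OF that] unfolding D by blast
  have sum: "finsum V (\<lambda>j. M *\<^sub>v (?P j *\<^sub>v l)) {..r} = M *\<^sub>v l" if "l \<in> balanced n g r" for l
    using finsum_coord_proj[OF M _ g] that by (simp add: balanced_def)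
  have from_D: "\<exists>l\<in>balanced n g r. \<forall>j\<le>r. u j = M *\<^sub>v (?P j *\<^sub>v l)"
    if u: "u \<in> (\<Pi> j\<in>{..r}. D j)" for u
  proof -
    have "\<forall>j. \<exists>l. j \<le> r \<longrightarrow> l \<in> zero_sum_on n (part n g j) \<and> u j = M *\<^sub>v l"
      using u unfolding D by fastforce
    then obtain l where l: "\<And>j. j \<le> r \<Longrightarrow> l j \<in> zero_sum_on n (part n g j)"
      "\<And>j. j \<le> r \<Longrightarrow> u j = M *\<^sub>v l j" by metis
    obtain l' where "l' \<in> balanced n g r" "\<And>j. j \<le> r \<Longrightarrow> ?P j *\<^sub>v l' = l j"
      by (rule glue_zero_sum[of r l n g]) (use l(1) in auto)
    thus ?thesis using l(2) by (metis (no_types))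
  qed
  have sum': "finsum V u {..r} = M *\<^sub>v l"
    if "l \<in> balanced n g r" "\<forall>j\<le>r. u j = M *\<^sub>v (?P j *\<^sub>v l)" for u l
  proof -
    have "M *\<^sub>v (?P j *\<^sub>v l) \<in> carrier_vec m" for j
      using that(1) by (intro mult_mat_vec_carrier[OF M] mult_mat_vec_carrier[OF coord_proj_carrier])
        (simp add: balanced_def)
    hence "finsum V u {..r} = finsum V (\<lambda>j. M *\<^sub>v (?P j *\<^sub>v l)) {..r}"
      using that(2) by (intro M.finsum_cong') auto
    thus ?thesis using sum[OF that(1)] by simp
  qed
  have "?join \<longleftrightarrow> (\<forall>u \<in> (\<Pi> j\<in>{..r}. D j). finsum V u {..r} \<in> S \<longrightarrow> (\<forall>j\<le>r. u j \<in> S))"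
    unfolding D_def
  proof (rule is_join_quotient_iff)
    show "Module.module class_ring V" by (rule vec_module)
    show "submodule class_ring S V" using S by simp
    show "w i \<in> carrier V" if "i \<in> part n g j" for i j
      using that w M by (auto simp: part_def module_vec_simps)
    fix x assume "x \<in> carrier V"
    then obtain l where l: "l \<in> balanced n g r" "x = M *\<^sub>v l"
      using surj by (auto simp: module_vec_simps)
    show "\<exists>u\<in>(\<Pi> j\<in>{..r}. difference_span V w (part n g j)). finsum V u {..r} = x"
      using to_D[OF l(1)] sum[OF l(1)] l(2) unfolding D_def by blast
  qed
  also have "\<dots> \<longleftrightarrow> ?crit"
  proof
    assume *: "\<forall>u \<in> (\<Pi> j\<in>{..r}. D j). finsum V u {..r} \<in> S \<longrightarrow> (\<forall>j\<le>r. u j \<in> S)"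
    show ?crit using *[rule_format, OF to_D] sum by auto
  next
    assume *: ?crit
    show "\<forall>u \<in> (\<Pi> j\<in>{..r}. D j). finsum V u {..r} \<in> S \<longrightarrow> (\<forall>j\<le>r. u j \<in> S)"
    proof (intro ballI impI allI)
      fix u j assume u: "u \<in> (\<Pi> j\<in>{..r}. D j)" "finsum V u {..r} \<in> S" and j: "j \<le> r"
      obtain l where l: "l \<in> balanced n g r" "\<forall>j\<le>r. u j = M *\<^sub>v (?P j *\<^sub>v l)"
        using from_D[OF u(1)] by blast
      show "u j \<in> S" using * l sum'[OF l] u(2) j by auto
    qed
  qed
  finally show ?thesis .
qed

section \<open>Spanning by homogeneous configurations\<close>

text \<open>
  Two affine combinations differ by a combination with coefficient sum zero; for the converse, add
  and subtract the first point.
\<close>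

lemma affine_directions:
  fixes A :: "'a::field mat"
  assumes A: "A \<in> carrier_mat m n" and n: "0 < n"
  shows "{x - y | x y. x \<in> affine_span A \<and> y \<in> affine_span A} = (*\<^sub>v) A ` zero_sum_on n {..<n}"
    (is "?X = _")
proof
  show "?X \<subseteq> (*\<^sub>v) A ` zero_sum_on n {..<n}"
  proof
    fix x assume "x \<in> ?X"
    then obtain k l where kl: "k \<in> carrier_vec n" "l \<in> carrier_vec n" "x = A *\<^sub>v k - A *\<^sub>v l"
      "(\<Sum>i<n. k $ i) = 1" "(\<Sum>i<n. l $ i) = 1"
      using A unfolding affine_span_def by auto
    have "(\<Sum>i<n. (k - l) $ i) = (\<Sum>i<n. k $ i - l $ i)" using kl by (intro sum.cong) auto
    hence "k - l \<in> zero_sum_on n {..<n}" using kl unfolding zero_sum_on_def by (auto simp: sum_subtractf)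
    moreover have "x = A *\<^sub>v (k - l)" using kl mult_minus_distrib_mat_vec[OF A kl(1,2)] by simp
    ultimately show "x \<in> (*\<^sub>v) A ` zero_sum_on n {..<n}" by blast
  qed
  show "(*\<^sub>v) A ` zero_sum_on n {..<n} \<subseteq> ?X"
  proof
    fix x assume "x \<in> (*\<^sub>v) A ` zero_sum_on n {..<n}"
    then obtain l where l: "l \<in> carrier_vec n" "(\<Sum>i<n. l $ i) = 0" "x = A *\<^sub>v l"
      unfolding zero_sum_on_def by auto
    let ?e = "unit_vec n 0 :: 'a vec"
    have e: "(\<Sum>i<n. ?e $ i) = 1"
    proof -
      have "(\<Sum>i<n. ?e $ i) = (\<Sum>i<n. if i = 0 then 1 else 0)"
        using n by (intro sum.cong) (auto simp: unit_vec_def)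
      thus ?thesis using n by simp
    qed
    have "(\<Sum>i<n. (l + ?e) $ i) = (\<Sum>i<n. l $ i + ?e $ i)" by (intro sum.cong) auto
    hence "(\<Sum>i<n. (l + ?e) $ i) = 1" using e l(2) by (simp add: sum.distrib)
    hence "A *\<^sub>v (l + ?e) \<in> affine_span A" "A *\<^sub>v ?e \<in> affine_span A"
      using e l A unfolding affine_span_def by auto
    moreover have "x = A *\<^sub>v (l + ?e) - A *\<^sub>v ?e"
    proof -
      have "(l + ?e) - ?e = l" using l by (intro eq_vecI) auto
      thus ?thesis using mult_minus_distrib_mat_vec[OF A, of "l + ?e" ?e] l by simp
    qed
    ultimately show "x \<in> ?X" by blast
  qed
qed

text \<open>
  A combination of the rows that equals \<open>(1, ..., 1)\<close> is a linear functional with value \<open>1\<close> on every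
  point.
\<close>

lemma homogeneous_functional:
  fixes A :: "'a::field mat"
  assumes A: "A \<in> carrier_mat m n" and h: "homogeneous A"
  obtains h where "h \<in> carrier_vec m" "\<And>l. l \<in> carrier_vec n \<Longrightarrow> h \<bullet> (A *\<^sub>v l) = (\<Sum>i<n. l $ i)"
proof -
  have At: "A\<^sup>T \<in> carrier_mat n m" using A by simp
  have "vec n (\<lambda>_. 1) \<in> lin_span n (set (cols A\<^sup>T))"
    using h A unfolding homogeneous_def by simp
  then obtain h where h: "h \<in> carrier_vec m" "A\<^sup>T *\<^sub>v h = vec n (\<lambda>_. 1)"
    unfolding lin_span_cols[OF At] by auto
  have "h \<bullet> (A *\<^sub>v l) = (\<Sum>i<n. l $ i)" if l: "l \<in> carrier_vec n" for l
    using transpose_vec_mult_scalar[OF A l h(1)] l unfolding h(2)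
    by (simp add: scalar_prod_def atLeast0LessThan)
  with h(1) that show ?thesis by blast
qed

text \<open>
  The functional of \<open>homogeneous_functional\<close> vanishes on the directions of the affine span and
  not on the points themselves. So the linear span is strictly larger than the \<open>d\<close>-dimensional space
  of directions, and hence is everything.
\<close>

lemma full_affine_dim_imp_surj:
  fixes A :: "'a::field mat"
  assumes A: "A \<in> carrier_mat (d + 1) n" and n: "0 < n"
    and hom: "homogeneous A" and dim: "affine_dim A = d"
  shows "(*\<^sub>v) A ` carrier_vec n = carrier_vec (d + 1)"
proof -
  let ?Z = "(*\<^sub>v) A ` zero_sum_on n {..<n}"
  let ?C = "(*\<^sub>v) A ` carrier_vec n"
  have Z: "is_subspace (d + 1) ?Z"
    by (rule is_subspace_image[OF is_subspace_zero_sum_on A]) simp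
  have C: "is_subspace (d + 1) ?C" by (rule is_subspace_image[OF is_subspace_carrier A])
  have sub: "?Z \<subseteq> ?C" unfolding zero_sum_on_def by auto
  have dZ: "lin_dim (d + 1) ?Z = d"
    using dim A unfolding affine_dim_def affine_directions[OF A n]
    by (simp add: lin_span_subspace[OF Z, simplified])
  obtain h where "h \<in> carrier_vec (d + 1)" and h: "\<And>l. l \<in> carrier_vec n \<Longrightarrow> h \<bullet> (A *\<^sub>v l) = (\<Sum>i<n. l $ i)"
    using homogeneous_functional[OF A hom] by blast
  have e: "(\<Sum>i<n. unit_vec n 0 $ i) = (1::'a)"
  proof -
    have "(\<Sum>i<n. unit_vec n 0 $ i) = (\<Sum>i<n. if i = 0 then 1 else (0::'a))"
      using n by (intro sum.cong) (auto simp: unit_vec_def)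
    thus ?thesis using n by simp
  qed
  have "A *\<^sub>v unit_vec n 0 \<notin> ?Z"
  proof
    assume "A *\<^sub>v unit_vec n 0 \<in> ?Z"
    then obtain l where l: "l \<in> zero_sum_on n {..<n}" "A *\<^sub>v unit_vec n 0 = A *\<^sub>v l" by auto
    hence "h \<bullet> (A *\<^sub>v unit_vec n 0) = 0" using h[of l] by (simp add: zero_sum_on_def)
    thus False using h[of "unit_vec n 0"] e by simp
  qed
  hence "?Z \<noteq> ?C" by (metis imageI unit_vec_carrier)
  hence "d < lin_dim (d + 1) ?C" using subspace_eqI_lin_dim[OF Z C sub] dZ by force
  hence "lin_dim (d + 1) (carrier_vec (d + 1) :: 'a vec set) \<le> lin_dim (d + 1) ?C"
    unfolding lin_dim_carrier by simp
  thus ?thesis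
    by (rule subspace_eqI_lin_dim[OF C is_subspace_carrier is_subspaceD(1)[OF C]])
qed

section \<open>Cayley decompositions in coordinates\<close>

definition fibre_mat :: "nat \<Rightarrow> nat \<Rightarrow> (nat \<Rightarrow> 'a::field vec) \<Rightarrow> 'a mat" where
  "fibre_mat m n w = mat m n (\<lambda>(a, i). w i $ a)"

lemma fibre_mat_carrier [simp]: "fibre_mat m n w \<in> carrier_mat m n"
  by (simp add: fibre_mat_def)

lemma cayley_mult_vec:
  fixes A T :: "'a::field mat"
  assumes A: "A \<in> carrier_mat (d + 1) n" and C: "cayley_decomposition d r A T g w"
    and l: "l \<in> carrier_vec n"
  shows "T *\<^sub>v (A *\<^sub>v l) =
    vec (r + 1) (\<lambda>j. \<Sum>i\<in>part n g j. l $ i) @\<^sub>v (fibre_mat (d - r) n w *\<^sub>v l)"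
proof -
  have T: "T \<in> carrier_mat (d + 1) (d + 1)" and rd: "r \<le> d"
    and w: "\<And>i. i < n \<Longrightarrow> w i \<in> carrier_vec (d - r)"
    and col: "\<And>i. i < n \<Longrightarrow> T *\<^sub>v col A i = unit_vec (r + 1) (g i) @\<^sub>v w i"
    using C A unfolding cayley_decomposition_def by auto
  have TA: "T * A \<in> carrier_mat (d + 1) n" using T A by simp
  have entry: "(T * A) $$ (a, i) = (unit_vec (r + 1) (g i) @\<^sub>v w i) $ a" if "a < d + 1" "i < n" for a i
  proof -
    have "(T * A) $$ (a, i) = (T *\<^sub>v col A i) $ a" using that T A by simp
    thus ?thesis using col that by simp
  qed
  show ?thesis
  proof (rule eq_vecI)
    show "dim_vec (T *\<^sub>v (A *\<^sub>v l)) =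
        dim_vec (vec (r + 1) (\<lambda>j. \<Sum>i\<in>part n g j. l $ i) @\<^sub>v (fibre_mat (d - r) n w *\<^sub>v l))"
      using T rd by (simp add: fibre_mat_def)
    fix a assume "a < dim_vec (vec (r + 1) (\<lambda>j. \<Sum>i\<in>part n g j. l $ i) @\<^sub>v (fibre_mat (d - r) n w *\<^sub>v l))"
    hence a: "a < d + 1" using rd by (simp add: fibre_mat_def)
    have "(T *\<^sub>v (A *\<^sub>v l)) $ a = ((T * A) *\<^sub>v l) $ a" using T A l by simp
    also have "\<dots> = (\<Sum>i<n. (T * A) $$ (a, i) * l $ i)" by (rule mult_mat_vec_index_sum[OF TA l a])
    also have "\<dots> = (\<Sum>i<n. (unit_vec (r + 1) (g i) @\<^sub>v w i) $ a * l $ i)"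
      using a by (intro sum.cong) (simp_all add: entry)
    also have "\<dots> = (vec (r + 1) (\<lambda>j. \<Sum>i\<in>part n g j. l $ i) @\<^sub>v (fibre_mat (d - r) n w *\<^sub>v l)) $ a"
    proof (cases "a < r + 1")
      case True
      have "(\<Sum>i<n. (unit_vec (r + 1) (g i) @\<^sub>v w i) $ a * l $ i) = (\<Sum>i<n. if g i = a then l $ i else 0)"
        using True by (intro sum.cong) (auto simp: unit_vec_def)
      also have "\<dots> = (\<Sum>i\<in>part n g a. l $ i)"
        by (rule sum.mono_neutral_cong_right) (auto simp: part_def)
      finally show ?thesis using True by simp
    next
      case False
      have a': "a - (r + 1) < d - r" using a False by simp
      have "(\<Sum>i<n. (unit_vec (r + 1) (g i) @\<^sub>v w i) $ a * l $ i) =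
          (\<Sum>i<n. fibre_mat (d - r) n w $$ (a - (r + 1), i) * l $ i)"
        using False a a' by (intro sum.cong) (auto simp: fibre_mat_def carrier_vecD[OF w])
      also have "\<dots> = (fibre_mat (d - r) n w *\<^sub>v l) $ (a - (r + 1))"
        by (rule mult_mat_vec_index_sum[OF fibre_mat_carrier l a', symmetric])
      finally show ?thesis using False a' by (simp add: fibre_mat_def)
    qed
    finally show "(T *\<^sub>v (A *\<^sub>v l)) $ a =
      (vec (r + 1) (\<lambda>j. \<Sum>i\<in>part n g j. l $ i) @\<^sub>v (fibre_mat (d - r) n w *\<^sub>v l)) $ a" .
  qed
qed

text \<open>
  The bound \<open>r \<le> d\<close> makes \<open>K\<^sup>r\<^sup>+\<^sup>1 \<times> K\<^sup>d\<^sup>-\<^sup>r\<close> have dimension \<open>d + 1\<close>, so that its zero vector is the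
  zero of \<open>T S\<close>.
\<close>

lemma is_subspace_fibre_part:
  fixes T :: "'a::field mat"
  assumes rd: "r \<le> d" and T: "T \<in> carrier_mat (d + 1) (d + 1)" and S: "is_subspace (d + 1) S"
  shows "is_subspace (d - r) (fibre_part d r T S)"
proof -
  have TS: "is_subspace (d + 1) ((*\<^sub>v) T ` S)" by (rule is_subspace_image[OF S T])
  note TSD = is_subspaceD[OF TS]
  show ?thesis
  proof (rule is_subspaceI)
    show "x + y \<in> fibre_part d r T S" if "x \<in> fibre_part d r T S" "y \<in> fibre_part d r T S" for x y
    proof -
      have c: "x \<in> carrier_vec (d - r)" "y \<in> carrier_vec (d - r)"
        "0\<^sub>v (r + 1) @\<^sub>v x \<in> (*\<^sub>v) T ` S" "0\<^sub>v (r + 1) @\<^sub>v y \<in> (*\<^sub>v) T ` S"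
        using that unfolding fibre_part_def by auto
      have "0\<^sub>v (r + 1) @\<^sub>v (x + y) = (0\<^sub>v (r + 1) @\<^sub>v x) + (0\<^sub>v (r + 1) @\<^sub>v y)"
        using c(1,2) by (intro eq_vecI) auto
      thus ?thesis using TSD(3)[OF c(3,4)] c(1,2) unfolding fibre_part_def by simp
    qed
    show "c \<cdot>\<^sub>v x \<in> fibre_part d r T S" if "x \<in> fibre_part d r T S" for c x
    proof -
      have x: "x \<in> carrier_vec (d - r)" "0\<^sub>v (r + 1) @\<^sub>v x \<in> (*\<^sub>v) T ` S"
        using that unfolding fibre_part_def by auto
      have "0\<^sub>v (r + 1) @\<^sub>v (c \<cdot>\<^sub>v x) = c \<cdot>\<^sub>v (0\<^sub>v (r + 1) @\<^sub>v x)"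
        using x(1) by (intro eq_vecI) auto
      thus ?thesis using TSD(4)[OF x(2)] x(1) unfolding fibre_part_def by simp
    qed
    have "0\<^sub>v (r + 1) @\<^sub>v 0\<^sub>v (d - r) = (0\<^sub>v (d + 1) :: 'a vec)" using rd by (intro eq_vecI) auto
    thus "0\<^sub>v (d - r) \<in> fibre_part d r T S" using TSD(2) unfolding fibre_part_def by simp
  qed (auto simp: fibre_part_def)
qed

section \<open>Gale duals\<close>

lemma gale_dual_image:
  fixes A B :: "'a::field mat"
  assumes A: "A \<in> carrier_mat m n" and B: "gale_dual A B"
  shows "B \<in> carrier_mat n (dim_col B)" "(*\<^sub>v) B ` carrier_vec (dim_col B) = mat_kernel A"
proof -
  interpret vec_space "TYPE('a)" n .
  have N: "is_subspace n (mat_kernel A)" by (rule is_subspace_mat_kernel[OF A])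
  show Bc: "B \<in> carrier_mat n (dim_col B)" using A B unfolding gale_dual_def by auto
  interpret N: vectorspace class_ring "vs (mat_kernel A)" by (rule subspace_is_vs[OF N])
  have "N.basis (set (cols B))" using A B unfolding gale_dual_def by simp
  hence sub: "set (cols B) \<subseteq> mat_kernel A" and gen: "N.span (set (cols B)) = mat_kernel A"
    unfolding N.basis_def by auto
  have "span (set (cols B)) = mat_kernel A"
    using span_li_not_depend(1)[OF sub] N gen by simp
  thus "(*\<^sub>v) B ` carrier_vec (dim_col B) = mat_kernel A"
    using lin_span_cols[OF Bc] unfolding lin_span_def by simp
qed

text \<open>
  Clearing the rows outside \<open>I\<close> does not change the span of the rows in \<open>I\<close>. The resulting matrix is
  \<open>coord_proj n I * B\<close>, and its row rank equals its column rank.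
\<close>

lemma lin_dim_row_span:
  fixes B :: "'a::field mat"
  assumes B: "B \<in> carrier_mat n k" and I: "I \<subseteq> {..<n}"
  shows "lin_dim k (row_span B I) =
    lin_dim n ((*\<^sub>v) (coord_proj n I) ` (*\<^sub>v) B ` carrier_vec k)"
proof -
  interpret vec_space "TYPE('a)" k .
  define C where "C = coord_proj n I * B"
  have C: "C \<in> carrier_mat n k" unfolding C_def using B by (intro mult_carrier_mat) auto
  have Ct: "C\<^sup>T \<in> carrier_mat k n" using C by simp
  have row: "row C i = (if i \<in> I then row B i else 0\<^sub>v k)" if i: "i < n" for i
  proof (rule eq_vecI)
    fix a assume "a < dim_vec (if i \<in> I then row B i else 0\<^sub>v k)"
    hence a: "a < k" using B by (auto split: if_splits)
    have "row C i $ a = (coord_proj n I *\<^sub>v col B a) $ i"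
      using i a B C by (simp add: C_def coord_proj_def)
    also have "\<dots> = (if i \<in> I then row B i else 0\<^sub>v k) $ a"
      using i a B by (subst coord_proj_mult) auto
    finally show "row C i $ a = (if i \<in> I then row B i else 0\<^sub>v k) $ a" .
  qed (use B C in auto)
  have rowI: "row B ` I \<subseteq> carrier_vec k" using B by auto
  have rowC: "set (rows C) \<subseteq> carrier_vec k" using C set_rows_carrier[of C n k] by auto
  have setC: "set (rows C) = row C ` {..<n}" using C unfolding rows_def by auto
  have s1: "submodule class_ring (span (row B ` I)) V" and s2: "submodule class_ring (span (set (rows C))) V"
    using span_is_submodule rowI rowC by auto
  have "span (set (rows C)) = span (row B ` I)"
  proof
    have "set (rows C) \<subseteq> span (row B ` I)"
      using row in_own_span[of "row B ` I"] rowI s1 unfolding setC submodule_def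
      by (auto simp: module_vec_simps)
    thus "span (set (rows C)) \<subseteq> span (row B ` I)" by (rule span_is_subset[OF _ s1])
    have "row B ` I \<subseteq> set (rows C)" using row I unfolding setC by force
    thus "span (row B ` I) \<subseteq> span (set (rows C))" by (rule span_is_monotone)
  qed
  hence "row_span B I = lin_span k (set (cols C\<^sup>T))"
    using B unfolding row_span_def lin_span_def by simp
  also have "\<dots> = (*\<^sub>v) C\<^sup>T ` carrier_vec n" by (rule lin_span_cols[OF Ct])
  finally have "lin_dim k (row_span B I) = lin_dim n ((*\<^sub>v) C ` carrier_vec k)"
    using lin_dim_image_transpose[OF C] by simp
  also have "(*\<^sub>v) C ` carrier_vec k = (*\<^sub>v) (coord_proj n I) ` (*\<^sub>v) B ` carrier_vec k"
    unfolding image_image C_def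
    by (rule image_cong[OF refl]) (rule assoc_mult_mat_vec[OF coord_proj_carrier B])
  finally show ?thesis .
qed

section \<open>Counting dimensions\<close>

theorem proposition4p7:
  fixes A B T :: "'a::field_char_0 mat"
    and d r n c :: nat
    and g :: "nat \<Rightarrow> nat"
    and w :: "nat \<Rightarrow> 'a vec"
  assumes "A \<in> carrier_mat (d + 1) n"
    and "\<not> pyramid A"
    and "homogeneous A"
    and "affine_dim A = d"
    and "cayley_decomposition d r A T g w"
    and "gale_dual A B"
    and "c = (LEAST k. \<exists>S. projects_to_join d r n T g w S \<and> lin_dim (d + 1) S = k)"
  shows "(\<forall>j\<le>r. dual_homogeneous B (part n g j)) \<and>
    int c = (\<Sum>j\<le>r. int (lin_dim (dim_col B) (row_span B (part n g j))))
      - int (lin_dim (dim_col B) (row_span B {..<n}))"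
proof -
  note A = assms(1) and C = assms(5)
  define m where "m = d - r"
  define N where "N = mat_kernel A"
  define M where "M = fibre_mat m n w"
  define P where "P j = (coord_proj n (part n g j) :: 'a mat)" for j
  define R where "R = block_sum n g (Suc r) N"
  define S0 where "S0 = (*\<^sub>v) A ` R"
  have rd: "r \<le> d" and T: "T \<in> carrier_mat (d + 1) (d + 1)" and Tinv: "invertible_mat T"
    and gim: "g ` {..<n} = {..r}"
    and wc: "\<And>i. i < n \<Longrightarrow> w i \<in> carrier_vec m"
    using C A unfolding cayley_decomposition_def m_def by auto
  have gr: "g i \<le> r" if "i < n" for i using gim that by blast
  have n0: "0 < n" using gim by (cases n) auto
  have M: "M \<in> carrier_mat m n" unfolding M_def by simp
  have N: "is_subspace n N" unfolding N_def by (rule is_subspace_mat_kernel[OF A])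
  have Nc: "N \<subseteq> carrier_vec n" by (rule is_subspaceD(1)[OF N])
  have R: "is_subspace n R" unfolding R_def by (rule is_subspace_block_sum[OF N])
  have Rc: "R \<subseteq> carrier_vec n" by (rule is_subspaceD(1)[OF R])
  have Ac: "A *\<^sub>v l \<in> carrier_vec (d + 1)" if "l \<in> carrier_vec n" for l
    by (rule mult_mat_vec_carrier[OF A that])
  have TA: "T *\<^sub>v (A *\<^sub>v l) = vec (r + 1) (\<lambda>j. \<Sum>i\<in>part n g j. l $ i) @\<^sub>v (M *\<^sub>v l)"
    if "l \<in> carrier_vec n" for l
    unfolding M_def m_def by (rule cayley_mult_vec[OF A C that])
  obtain T' where T': "T' \<in> carrier_mat (d + 1) (d + 1)" "T' * T = 1\<^sub>m (d + 1)" "T * T' = 1\<^sub>m (d + 1)"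
  proof -
    from Tinv obtain U where U: "T * U = 1\<^sub>m (dim_row T)" "U * T = 1\<^sub>m (dim_row U)"
      unfolding invertible_mat_def inverts_mat_def by auto
    have "dim_col (T * U) = d + 1" "dim_col (U * T) = dim_row U" unfolding U using T by auto
    hence "U \<in> carrier_mat (d + 1) (d + 1)" using T by auto
    thus ?thesis using that[of U] U T by auto
  qed
  have Tinj: "x = y" if x: "x \<in> carrier_vec (d + 1)" and y: "y \<in> carrier_vec (d + 1)"
    and eq: "T *\<^sub>v x = T *\<^sub>v y" for x y
  proof -
    have "x = T' *\<^sub>v (T *\<^sub>v x)" "y = T' *\<^sub>v (T *\<^sub>v y)"
      using x y T'(2) assoc_mult_mat_vec[OF T'(1) T x] assoc_mult_mat_vec[OF T'(1) T y] by simp_all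
    thus ?thesis using eq by simp
  qed
  have bal0: "vec (r + 1) (\<lambda>j. \<Sum>i\<in>part n g j. l $ i) = 0\<^sub>v (r + 1) \<longleftrightarrow> l \<in> balanced n g r"
    if "l \<in> carrier_vec n" for l :: "'a vec"
    using that by (auto simp: balanced_def vec_eq_iff less_Suc_eq_le)
  \<comment> \<open>Balanced vectors are those whose image under \<open>T A\<close> lies in the fibre \<open>{0} \<times> K\<^sup>d\<^sup>-\<^sup>r\<close>.\<close>
  have TA_bal: "T *\<^sub>v (A *\<^sub>v l) = 0\<^sub>v (r + 1) @\<^sub>v (M *\<^sub>v l)" if l: "l \<in> balanced n g r" for l
    using TA[of l] bal0[of l] l by (simp add: balanced_def)
  have zero_app: "0\<^sub>v (d + 1) = 0\<^sub>v (r + 1) @\<^sub>v (0\<^sub>v m :: 'a vec)"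
    using rd by (intro eq_vecI) (auto simp: m_def)
  have N_iff: "l \<in> N \<longleftrightarrow> l \<in> balanced n g r \<and> M *\<^sub>v l = 0\<^sub>v m" if l: "l \<in> carrier_vec n" for l
  proof -
    have "l \<in> N \<longleftrightarrow> A *\<^sub>v l = 0\<^sub>v (d + 1)" unfolding N_def using mat_kernel[OF A] l by auto
    also have "\<dots> \<longleftrightarrow> T *\<^sub>v (A *\<^sub>v l) = 0\<^sub>v (d + 1)"
      using Tinj[OF Ac[OF l], of "0\<^sub>v (d + 1)"] mult_mat_zero_vec[OF T] by auto
    also have "\<dots> \<longleftrightarrow> l \<in> balanced n g r \<and> M *\<^sub>v l = 0\<^sub>v m"
      unfolding TA[OF l] zero_app using bal0[OF l] by (subst append_vec_eq[of _ "r + 1"]) auto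
    finally show ?thesis .
  qed
  have N_bal: "N \<subseteq> balanced n g r" 
  proof
    fix l assume l: "l \<in> N"
    show "l \<in> balanced n g r" using N_iff[OF subsetD[OF Nc l]] l by simp
  qed
  have P_bal: "P j *\<^sub>v l \<in> balanced n g r" if "j \<le> r" "l \<in> balanced n g r" for j l
    unfolding P_def by (rule subsetD[OF zero_sum_on_part_balanced coord_proj_balanced[OF that(2,1)]])
  have PN_R: "P j *\<^sub>v u \<in> R" if "j \<le> r" "u \<in> N" for j u
    unfolding P_def R_def by (rule coord_proj_mem_block_sum[OF N that(2)]) (use that in simp)
  have R_least: "R \<subseteq> X" if "is_subspace n X" "\<And>j u. j \<le> r \<Longrightarrow> u \<in> N \<Longrightarrow> P j *\<^sub>v u \<in> X" for X
    unfolding R_def using that by (intro block_sum_least[OF N]) (auto simp: P_def)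
  have R_bal: "R \<subseteq> balanced n g r"
    by (rule R_least[OF is_subspace_balanced]) (rule P_bal[OF _ subsetD[OF N_bal]])
  have NR: "N \<subseteq> R" unfolding R_def by (rule subset_block_sum[OF N]) (use gr in \<open>simp add: less_Suc_eq_le\<close>)
  have Asurj: "(*\<^sub>v) A ` carrier_vec n = carrier_vec (d + 1)"
    by (rule full_affine_dim_imp_surj[OF A n0 assms(3,4)])
  \<comment> \<open>Since \<open>T A\<close> hits every vector of the fibre, the difference spans generate \<open>K\<^sup>d\<^sup>-\<^sup>r\<close>.\<close>
  have Msurj: "(*\<^sub>v) M ` balanced n g r = carrier_vec m"
  proof
    show "(*\<^sub>v) M ` balanced n g r \<subseteq> carrier_vec m"
    proof (rule image_subsetI)
      fix l :: "'a vec" assume "l \<in> balanced n g r"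
      thus "M *\<^sub>v l \<in> carrier_vec m" by (intro mult_mat_vec_carrier[OF M]) (simp add: balanced_def)
    qed
    show "carrier_vec m \<subseteq> (*\<^sub>v) M ` balanced n g r"
    proof
      fix y :: "'a vec" assume y: "y \<in> carrier_vec m"
      have z: "0\<^sub>v (r + 1) @\<^sub>v y \<in> carrier_vec (d + 1)" 
        by (rule carrier_vecI) (simp only: index_append_vec index_zero_vec carrier_vecD[OF y], use rd m_def in linarith)
      have "T' *\<^sub>v (0\<^sub>v (r + 1) @\<^sub>v y) \<in> (*\<^sub>v) A ` carrier_vec n"
        unfolding Asurj by (rule mult_mat_vec_carrier[OF T'(1) z])
      then obtain l where l: "l \<in> carrier_vec n" "A *\<^sub>v l = T' *\<^sub>v (0\<^sub>v (r + 1) @\<^sub>v y)"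
        by (metis imageE)
      have "T *\<^sub>v (A *\<^sub>v l) = (T * T') *\<^sub>v (0\<^sub>v (r + 1) @\<^sub>v y)"
        unfolding l(2) by (rule assoc_mult_mat_vec[OF T T'(1) z, symmetric])
      hence "vec (r + 1) (\<lambda>j. \<Sum>i\<in>part n g j. l $ i) @\<^sub>v (M *\<^sub>v l) = 0\<^sub>v (r + 1) @\<^sub>v y"
        unfolding TA[OF l(1)] T'(3) one_mult_mat_vec[OF z] .
      hence "vec (r + 1) (\<lambda>j. \<Sum>i\<in>part n g j. l $ i) = 0\<^sub>v (r + 1) \<and> M *\<^sub>v l = y"
        by (subst (asm) append_vec_eq[of _ "r + 1"]) (rule vec_carrier zero_carrier_vec | assumption)+
      hence "l \<in> balanced n g r \<and> M *\<^sub>v l = y" unfolding bal0[OF l(1)] .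
      thus "y \<in> (*\<^sub>v) M ` balanced n g r" by blast
    qed
  qed
  have fibre_mem: "M *\<^sub>v l \<in> fibre_part d r T S \<longleftrightarrow> A *\<^sub>v l \<in> S"
    if l: "l \<in> balanced n g r" and S: "S \<subseteq> carrier_vec (d + 1)" for l S
  proof -
    have lc: "l \<in> carrier_vec n" using l by (simp add: balanced_def)
    have "M *\<^sub>v l \<in> fibre_part d r T S \<longleftrightarrow> T *\<^sub>v (A *\<^sub>v l) \<in> (*\<^sub>v) T ` S"
      unfolding fibre_part_def TA_bal[OF l] using mult_mat_vec_carrier[OF M lc] by (simp add: m_def)
    also have "\<dots> \<longleftrightarrow> A *\<^sub>v l \<in> S"
      using Tinj[OF Ac[OF lc]] S by blast
    finally show ?thesis .
  qed
  \<comment> \<open>The join criterion, transported from the fibre part of \<open>S\<close> in \<open>K\<^sup>d\<^sup>-\<^sup>r\<close> to \<open>S\<close> itself.\<close>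
  have valid_iff: "projects_to_join d r n T g w S \<longleftrightarrow>
      (*\<^sub>v) T ` S \<subseteq> {0\<^sub>v (r + 1) @\<^sub>v u | u. u \<in> carrier_vec m} \<and>
      (\<forall>l\<in>balanced n g r. A *\<^sub>v l \<in> S \<longrightarrow> (\<forall>j\<le>r. A *\<^sub>v (P j *\<^sub>v l) \<in> S))"
    if S: "is_subspace (d + 1) S" for S
  proof -
    have Sc: "S \<subseteq> carrier_vec (d + 1)" by (rule is_subspaceD(1)[OF S])
    have F: "is_subspace m (fibre_part d r T S)" unfolding m_def by (rule is_subspace_fibre_part[OF rd T S])
    have wM: "w i = col M i" if "i < n" for i
      using wc[OF that] that unfolding M_def fibre_mat_def by (intro eq_vecI) auto
    have "is_join (quotient_space (module_vec TYPE('a) m) (fibre_part d r T S)) r n g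
        (\<lambda>i. fibre_part d r T S +>\<^bsub>module_vec TYPE('a) m\<^esub> w i) \<longleftrightarrow>
      (\<forall>l\<in>balanced n g r. M *\<^sub>v l \<in> fibre_part d r T S \<longrightarrow>
         (\<forall>j\<le>r. M *\<^sub>v (P j *\<^sub>v l) \<in> fibre_part d r T S))"
      unfolding P_def by (rule is_join_quotient_coeff[OF F M wM gr Msurj])
    also have "\<dots> \<longleftrightarrow> (\<forall>l\<in>balanced n g r. A *\<^sub>v l \<in> S \<longrightarrow> (\<forall>j\<le>r. A *\<^sub>v (P j *\<^sub>v l) \<in> S))"
      by (intro ball_cong imp_cong all_cong refl) (use fibre_mem[OF _ Sc] fibre_mem[OF P_bal Sc] in blast)+
    finally show ?thesis using S unfolding projects_to_join_def m_def by simp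
  qed
  have S0: "is_subspace (d + 1) S0" unfolding S0_def by (rule is_subspace_image[OF R A])
  have S0_valid: "projects_to_join d r n T g w S0"
    unfolding valid_iff[OF S0]
  proof (intro conjI ballI impI allI)
    show "(*\<^sub>v) T ` S0 \<subseteq> {0\<^sub>v (r + 1) @\<^sub>v u | u. u \<in> carrier_vec m}"
    proof
      fix x assume "x \<in> (*\<^sub>v) T ` S0"
      then obtain v where v: "v \<in> R" "x = T *\<^sub>v (A *\<^sub>v v)" unfolding S0_def by auto
      have "x = 0\<^sub>v (r + 1) @\<^sub>v (M *\<^sub>v v)" unfolding v(2) using TA_bal v(1) R_bal by blast
      moreover have "M *\<^sub>v v \<in> carrier_vec m" using v(1) Rc by (intro mult_mat_vec_carrier[OF M]) auto
      ultimately show "x \<in> {0\<^sub>v (r + 1) @\<^sub>v u | u. u \<in> carrier_vec m}" by blast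
    qed
    fix l j assume l: "l \<in> balanced n g r" and Al: "A *\<^sub>v l \<in> S0" and j: "j \<le> r"
    have lc: "l \<in> carrier_vec n" using l by (simp add: balanced_def)
    obtain v where v: "v \<in> R" "A *\<^sub>v l = A *\<^sub>v v" using Al unfolding S0_def by auto
    have vc: "v \<in> carrier_vec n" using v Rc by auto
    have Pv: "P j *\<^sub>v v \<in> R"
    proof -
      obtain u where "u \<in> N" "P j *\<^sub>v v = P j *\<^sub>v u"
        using v(1) j unfolding R_def block_sum_def P_def by (auto simp: less_Suc_eq_le)
      thus ?thesis using PN_R[OF j] by simp
    qed
    have "A *\<^sub>v (l - v) = 0\<^sub>v (d + 1)"
      using mult_minus_distrib_mat_vec[OF A lc vc] v(2) Ac[OF vc] by simp
    \<comment> \<open>\<open>R\<close> contains the projections of \<open>N\<close> and is closed under each \<open>P j\<close>.\<close>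
    hence "l - v \<in> N" unfolding N_def mat_kernel[OF A] using lc vc by auto
    hence "P j *\<^sub>v (l - v) \<in> R" by (rule PN_R[OF j])
    hence "P j *\<^sub>v (l - v) + P j *\<^sub>v v \<in> R" using Pv by (rule is_subspaceD(3)[OF R])
    moreover have "P j *\<^sub>v (l - v) + P j *\<^sub>v v = P j *\<^sub>v l"
      using lc vc unfolding P_def by (intro eq_vecI) (auto simp: coord_proj_mult)
    ultimately show "A *\<^sub>v (P j *\<^sub>v l) \<in> S0" unfolding S0_def by auto
  qed
  have S0_least: "lin_dim (d + 1) S0 \<le> lin_dim (d + 1) S" if pj: "projects_to_join d r n T g w S" for S
  proof -
    have S: "is_subspace (d + 1) S" using pj unfolding projects_to_join_def by simp
    have "R \<subseteq> {l \<in> carrier_vec n. A *\<^sub>v l \<in> S}"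
    proof (rule R_least)
      show "is_subspace n {l \<in> carrier_vec n. A *\<^sub>v l \<in> S}"
        by (rule is_subspace_preimage[OF is_subspace_carrier S A])
      fix j u assume j: "j \<le> r" and u: "u \<in> N"
      \<comment> \<open>The criterion applies to \<open>u\<close> because \<open>A u = 0\<close> lies in every subspace.\<close>
      have "A *\<^sub>v u = 0\<^sub>v (d + 1)" using u unfolding N_def mat_kernel[OF A] by auto
      hence "A *\<^sub>v u \<in> S" using is_subspaceD(2)[OF S] by simp
      hence "A *\<^sub>v (P j *\<^sub>v u) \<in> S" using pj valid_iff[OF S] N_bal u j by blast
      thus "P j *\<^sub>v u \<in> {l \<in> carrier_vec n. A *\<^sub>v l \<in> S}" using PN_R[OF j u] Rc by blast
    qed
    hence "S0 \<subseteq> S" unfolding S0_def by auto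
    thus ?thesis by (rule lin_dim_mono[OF S0 S])
  qed
  have c: "c = lin_dim (d + 1) S0"
    unfolding assms(7) by (rule Least_equality) (use S0_valid S0_least in blast)+
  \<comment> \<open>Rank-nullity for \<open>A\<close> on \<open>R\<close>: its kernel there is all of \<open>N\<close>.\<close>
  have "{x \<in> R. A *\<^sub>v x = 0\<^sub>v (d + 1)} = N"
    using NR Rc Nc unfolding N_def mat_kernel[OF A] by auto
  hence dimR: "lin_dim n R = c + lin_dim n N"
    using rank_nullity_mat[OF R A] unfolding c S0_def by simp
  define k where "k = dim_col B"
  have B: "B \<in> carrier_mat n k" "(*\<^sub>v) B ` carrier_vec k = N"
    unfolding k_def N_def by (fact gale_dual_image[OF A assms(6)])+
  have dim_part: "lin_dim k (row_span B (part n g j)) = lin_dim n ((*\<^sub>v) (P j) ` N)" for j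
    using lin_dim_row_span[OF B(1) part_subset] unfolding B(2) P_def .
  have "(*\<^sub>v) (coord_proj n {..<n}) ` N = (\<lambda>u. u) ` N"
  proof (rule image_cong[OF refl])
    fix u assume "u \<in> N"
    hence u: "u \<in> carrier_vec n" using Nc by blast
    show "coord_proj n {..<n} *\<^sub>v u = u"
      unfolding coord_proj_mult[OF u] by (rule eq_vecI) (simp_all add: carrier_vecD[OF u])
  qed
  hence dim_all: "lin_dim k (row_span B {..<n}) = lin_dim n N"
    using lin_dim_row_span[OF B(1), of "{..<n}"] unfolding B(2) by simp
  have dimR_sum: "lin_dim n R = (\<Sum>j\<le>r. lin_dim k (row_span B (part n g j)))"
    unfolding R_def lin_dim_block_sum[OF N] dim_part P_def lessThan_Suc_atMost ..
  have "int c = (\<Sum>j\<le>r. int (lin_dim k (row_span B (part n g j)))) - int (lin_dim k (row_span B {..<n}))"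
    unfolding dim_all of_nat_sum[symmetric] dimR_sum[symmetric] dimR by simp
  moreover have "dual_homogeneous B (part n g j)" if j: "j \<le> r" for j
    unfolding dual_homogeneous_def k_def[symmetric]
  proof (rule eq_vecI)
    have rc: "row B \<in> part n g j \<rightarrow> carrier_vec k" using B(1) by auto
    show "dim_vec (finsum_vec TYPE('a) k (row B) (part n g j)) = dim_vec (0\<^sub>v k)"
      using finsum_vec_closed[OF rc] by simp
    fix a assume "a < dim_vec (0\<^sub>v k)"
    hence a: "a < k" by simp
    have "B *\<^sub>v unit_vec k a \<in> N" unfolding B(2)[symmetric] by auto
    moreover have "B *\<^sub>v unit_vec k a = col B a" using a B(1) by (intro eq_vecI) auto
    ultimately have "col B a \<in> balanced n g r" using N_bal by auto
    hence "(\<Sum>i\<in>part n g j. col B a $ i) = 0" using j by (simp add: balanced_def)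
    moreover have "(\<Sum>i\<in>part n g j. col B a $ i) = (\<Sum>i\<in>part n g j. row B i $ a)"
      using a B(1) by (intro sum.cong) (auto simp: part_def)
    ultimately show "finsum_vec TYPE('a) k (row B) (part n g j) $ a = 0\<^sub>v k $ a"
      using index_finsum_vec[OF finite_part a rc] a by simp
  qed
  ultimately show ?thesis unfolding k_def by blast
qed

end
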